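(* The blocked-braid group $\mathbf{BB}_3$ is finite, of order $6$ or $12$.
   Context: Composition of arrows is written by juxtaposition, $fg$ meaning first $g$, then $f$. A braided strict monoidal category is a category with a strictly associative and unitary tensor functor $\otimes$ with unit $I$, and a natural family of isomorphisms (twist) $\tau_{A,B}:A\otimes B\to B\otimes A$ such that $\tau_{A,B\otimes C}=(1_B\otimes\tau_{A,C})(\tau_{A,B}\otimes 1_C)$ and $\tau_{A\otimes B,C}=(\tau_{A,C}\otimes 1_B)(1_A\otimes\tau_{B,C})$. $A^n$ denotes the $n$-fold tensor power of $A$. A tangle algebra in such a category is an object $A$ with arrows $\eta:I\to A\otimes A$ and $\epsilon:A\otimes A\to I$ satisfying $(\epsilon\otimes 1_A)(1_A\otimes\eta)=1_A=(1_A\otimes\epsilon)(\eta\otimes 1_A)$, $\epsilon\tau_{A,A}=\epsilon$ and $\tau_{A,A}\eta=\eta$. $\mathbf{Tangle}_n$ is the free braided strict monoidal category generated by an object $A$ with a tangle algebra structure and two arrows $R:I\to A^n$ and $S:A^n\to I$ (subject to no further equations). A braid in $\mathbf{Tangle}_n$ is an arrow $B:A^n\to A^n$ that is a composite of arrows each of which is a tensor of identities and arrows $\tau_{A,A}$ or $\tau_{A,A}^{-1}$. A blocked braid on $n$ strings is an arrow $I\to I$ of $\mathbf{Tangle}_n$ of the form $SBR$ with $B$ a braid; equality of blocked braids is equality of arrows in $\mathbf{Tangle}_n$. The blocked-braid group $\mathbf{BB}_n$ has as elements the blocked braids on $n$ strings, identity $S1_{A^n}R$, product $(SBR)(SB'R)=SBB'R$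 and inverse $(SBR)^{-1}=SB^{-1}R$ (these operations are well defined). *)

theory Defs
  imports "HOL-Algebra.Coset"
begin

section \<open>Braided strict monoidal categories\<close>

text \<open>
  Composition is written in applicative order: \<open>f \<cdot> g\<close> is first \<open>g\<close>, then \<open>f\<close>. It is only
  meaningful when \<open>Dom C f = Cod C g\<close>; nothing is assumed about its value otherwise.
\<close>

record ('o, 'a) tensor_category =
  Ob :: "'o set"
  Arr :: "'a set"
  Dom :: "'a \<Rightarrow> 'o"
  Cod :: "'a \<Rightarrow> 'o"
  Idn :: "'o \<Rightarrow> 'a"  (\<open>\<iota>\<index>\<close>)
  Cmp :: "'a \<Rightarrow> 'a \<Rightarrow> 'a"  (infixr \<open>\<cdot>\<index>\<close> 70)
  Ten_o :: "'o \<Rightarrow> 'o \<Rightarrow> 'o"  (infixr \<open>\<otimes>\<^sub>o\<index>\<close> 75)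
  Ten_a :: "'a \<Rightarrow> 'a \<Rightarrow> 'a"  (infixr \<open>\<otimes>\<^sub>a\<index>\<close> 75)
  Unit :: "'o"  (\<open>\<I>\<index>\<close>)
  Twist :: "'o \<Rightarrow> 'o \<Rightarrow> 'a"  (\<open>\<tau>\<index>\<close>)

definition Hom :: "('o, 'a, 'z) tensor_category_scheme \<Rightarrow> 'o \<Rightarrow> 'o \<Rightarrow> 'a set" where
  "Hom C X Y = {f \<in> Arr C. Dom C f = X \<and> Cod C f = Y}"

definition inverse_arrows :: "('o, 'a, 'z) tensor_category_scheme \<Rightarrow> 'a \<Rightarrow> 'a \<Rightarrow> bool" where
  "inverse_arrows C f g \<longleftrightarrow>
     f \<in> Arr C \<and> g \<in> Hom C (Cod C f) (Dom C f) \<and>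
     Cmp C g f = Idn C (Dom C f) \<and> Cmp C f g = Idn C (Cod C f)"

primrec tpow :: "('o, 'a, 'z) tensor_category_scheme \<Rightarrow> 'o \<Rightarrow> nat \<Rightarrow> 'o" where
  "tpow C A 0 = Unit C"
| "tpow C A (Suc k) = Ten_o C (tpow C A k) A"

locale braided_strict_monoidal_category =
  fixes C :: "('o, 'a, 'z) tensor_category_scheme" (structure)
  assumes Dom_in_Ob: "f \<in> Arr C \<Longrightarrow> Dom C f \<in> Ob C"
    and Cod_in_Ob: "f \<in> Arr C \<Longrightarrow> Cod C f \<in> Ob C"
    and Idn_Hom: "X \<in> Ob C \<Longrightarrow> \<iota> X \<in> Hom C X X"
    and Cmp_Hom: "\<lbrakk>f \<in> Hom C Y Z; g \<in> Hom C X Y\<rbrakk> \<Longrightarrow> f \<cdot> g \<in> Hom C X Z"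
    and Idn_left: "f \<in> Hom C X Y \<Longrightarrow> \<iota> Y \<cdot> f = f"
    and Idn_right: "f \<in> Hom C X Y \<Longrightarrow> f \<cdot> \<iota> X = f"
    and Cmp_assoc: "\<lbrakk>f \<in> Hom C Y Z; g \<in> Hom C X Y; h \<in> Hom C W X\<rbrakk> \<Longrightarrow> (f \<cdot> g) \<cdot> h = f \<cdot> (g \<cdot> h)"
    and Unit_in_Ob: "\<I> \<in> Ob C"
    and Ten_o_in_Ob: "\<lbrakk>X \<in> Ob C; Y \<in> Ob C\<rbrakk> \<Longrightarrow> X \<otimes>\<^sub>o Y \<in> Ob C"
    and Ten_o_assoc: "\<lbrakk>X \<in> Ob C; Y \<in> Ob C; Z \<in> Ob C\<rbrakk> \<Longrightarrow> (X \<otimes>\<^sub>o Y) \<otimes>\<^sub>o Z = X \<otimes>\<^sub>o (Y \<otimes>\<^sub>o Z)"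
    and Ten_o_left: "X \<in> Ob C \<Longrightarrow> \<I> \<otimes>\<^sub>o X = X"
    and Ten_o_right: "X \<in> Ob C \<Longrightarrow> X \<otimes>\<^sub>o \<I> = X"
    and Ten_a_Hom: "\<lbrakk>f \<in> Hom C X Y; f' \<in> Hom C X' Y'\<rbrakk> \<Longrightarrow> f \<otimes>\<^sub>a f' \<in> Hom C (X \<otimes>\<^sub>o X') (Y \<otimes>\<^sub>o Y')"
    and Ten_a_Idn: "\<lbrakk>X \<in> Ob C; Y \<in> Ob C\<rbrakk> \<Longrightarrow> \<iota> X \<otimes>\<^sub>a \<iota> Y = \<iota> (X \<otimes>\<^sub>o Y)"
    and Ten_a_Cmp: "\<lbrakk>f \<in> Hom C Y Z; g \<in> Hom C X Y; f' \<in> Hom C Y' Z'; g' \<in> Hom C X' Y'\<rbrakk>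
           \<Longrightarrow> (f \<cdot> g) \<otimes>\<^sub>a (f' \<cdot> g') = (f \<otimes>\<^sub>a f') \<cdot> (g \<otimes>\<^sub>a g')"
    and Ten_a_assoc: "\<lbrakk>f \<in> Arr C; g \<in> Arr C; h \<in> Arr C\<rbrakk> \<Longrightarrow> (f \<otimes>\<^sub>a g) \<otimes>\<^sub>a h = f \<otimes>\<^sub>a (g \<otimes>\<^sub>a h)"
    and Ten_a_left: "f \<in> Arr C \<Longrightarrow> \<iota> \<I> \<otimes>\<^sub>a f = f"
    and Ten_a_right: "f \<in> Arr C \<Longrightarrow> f \<otimes>\<^sub>a \<iota> \<I> = f"
    and Twist_Hom: "\<lbrakk>X \<in> Ob C; Y \<in> Ob C\<rbrakk> \<Longrightarrow> \<tau> X Y \<in> Hom C (X \<otimes>\<^sub>o Y) (Y \<otimes>\<^sub>o X)"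
    and Twist_iso: "\<lbrakk>X \<in> Ob C; Y \<in> Ob C\<rbrakk> \<Longrightarrow> \<exists>g. inverse_arrows C (\<tau> X Y) g"
    and Twist_natural: "\<lbrakk>f \<in> Hom C X Y; g \<in> Hom C X' Y'\<rbrakk>
           \<Longrightarrow> \<tau> Y Y' \<cdot> (f \<otimes>\<^sub>a g) = (g \<otimes>\<^sub>a f) \<cdot> \<tau> X X'"
    and Twist_right: "\<lbrakk>X \<in> Ob C; Y \<in> Ob C; Z \<in> Ob C\<rbrakk>
           \<Longrightarrow> \<tau> X (Y \<otimes>\<^sub>o Z) = (\<iota> Y \<otimes>\<^sub>a \<tau> X Z) \<cdot> (\<tau> X Y \<otimes>\<^sub>a \<iota> Z)"
    and Twist_left: "\<lbrakk>X \<in> Ob C; Y \<in> Ob C; Z \<in> Ob C\<rbrakk>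
           \<Longrightarrow> \<tau> (X \<otimes>\<^sub>o Y) Z = (\<tau> X Z \<otimes>\<^sub>a \<iota> Y) \<cdot> (\<iota> X \<otimes>\<^sub>a \<tau> Y Z)"

locale tangle_algebra = braided_strict_monoidal_category C
  for C :: "('o, 'a, 'z) tensor_category_scheme" (structure) +
  fixes A :: 'o and \<eta> \<epsilon> :: 'a
  assumes A_in_Ob: "A \<in> Ob C"
    and eta_Hom: "\<eta> \<in> Hom C \<I> (A \<otimes>\<^sub>o A)"
    and eps_Hom: "\<epsilon> \<in> Hom C (A \<otimes>\<^sub>o A) \<I>"
    and snake_left: "(\<epsilon> \<otimes>\<^sub>a \<iota> A) \<cdot> (\<iota> A \<otimes>\<^sub>a \<eta>) = \<iota> A"
    and snake_right: "(\<iota> A \<otimes>\<^sub>a \<epsilon>) \<cdot> (\<eta> \<otimes>\<^sub>a \<iota> A) = \<iota> A"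
    and eps_Twist: "\<epsilon> \<cdot> \<tau> A A = \<epsilon>"
    and Twist_eta: "\<tau> A A \<cdot> \<eta> = \<eta>"

locale blocked_tangle_algebra = tangle_algebra C A \<eta> \<epsilon>
  for C :: "('o, 'a, 'z) tensor_category_scheme" (structure) and A \<eta> \<epsilon> +
  fixes n :: nat and R S :: 'a
  assumes R_Hom: "R \<in> Hom C \<I> (tpow C A n)"
    and S_Hom: "S \<in> Hom C (tpow C A n) \<I>"

locale strict_braided_functor =
  fixes C :: "('o, 'a, 'z) tensor_category_scheme"
    and D :: "('p, 'b, 'y) tensor_category_scheme"
    and Fo :: "'o \<Rightarrow> 'p" and Fa :: "'a \<Rightarrow> 'b"
  assumes Fo_Ob: "X \<in> Ob C \<Longrightarrow> Fo X \<in> Ob D"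
    and Fa_Hom: "f \<in> Hom C X Y \<Longrightarrow> Fa f \<in> Hom D (Fo X) (Fo Y)"
    and Fa_Idn: "X \<in> Ob C \<Longrightarrow> Fa (Idn C X) = Idn D (Fo X)"
    and Fa_Cmp: "\<lbrakk>f \<in> Hom C Y Z; g \<in> Hom C X Y\<rbrakk> \<Longrightarrow> Fa (Cmp C f g) = Cmp D (Fa f) (Fa g)"
    and Fo_Unit: "Fo (Unit C) = Unit D"
    and Fo_Ten: "\<lbrakk>X \<in> Ob C; Y \<in> Ob C\<rbrakk> \<Longrightarrow> Fo (Ten_o C X Y) = Ten_o D (Fo X) (Fo Y)"
    and Fa_Ten: "\<lbrakk>f \<in> Arr C; g \<in> Arr C\<rbrakk> \<Longrightarrow> Fa (Ten_a C f g) = Ten_a D (Fa f) (Fa g)"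
    and Fa_Twist: "\<lbrakk>X \<in> Ob C; Y \<in> Ob C\<rbrakk> \<Longrightarrow> Fa (Twist C X Y) = Twist D (Fo X) (Fo Y)"


section \<open>The free category on a tangle algebra with two blocks\<close>

text \<open>
  The objects of the free braided strict monoidal category on one object \<open>A\<close> are the tensor
  powers of \<open>A\<close>, represented here by their exponents. Arrows are well-typed terms modulo the least
  congruence containing the axioms. The lemmas \<open>Tangle_blocked_tangle_algebra\<close>,
  \<open>Tangle_free_existence\<close> and \<open>Tangle_free_uniqueness\<close> below establish the universal property.
\<close>

datatype tangle_term =
    TIdn nat
  | TCmp tangle_term tangle_term
  | TTen tangle_term tangle_term
  | TTwist nat nat
  | TTwistInv nat nat
  | TEta
  | TEps
  | TR
  | TS

primrec tdom :: "nat \<Rightarrow> tangle_term \<Rightarrow> nat" where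
  "tdom n (TIdn k) = k"
| "tdom n (TCmp t u) = tdom n u"
| "tdom n (TTen t u) = tdom n t + tdom n u"
| "tdom n (TTwist j k) = j + k"
| "tdom n (TTwistInv j k) = k + j"
| "tdom n TEta = 0"
| "tdom n TEps = 2"
| "tdom n TR = 0"
| "tdom n TS = n"

primrec tcod :: "nat \<Rightarrow> tangle_term \<Rightarrow> nat" where
  "tcod n (TIdn k) = k"
| "tcod n (TCmp t u) = tcod n t"
| "tcod n (TTen t u) = tcod n t + tcod n u"
| "tcod n (TTwist j k) = k + j"
| "tcod n (TTwistInv j k) = j + k"
| "tcod n TEta = 2"
| "tcod n TEps = 0"
| "tcod n TR = n"
| "tcod n TS = 0"

primrec twf :: "nat \<Rightarrow> tangle_term \<Rightarrow> bool" where
  "twf n (TIdn k) \<longleftrightarrow> True"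
| "twf n (TCmp t u) \<longleftrightarrow> twf n t \<and> twf n u \<and> tdom n t = tcod n u"
| "twf n (TTen t u) \<longleftrightarrow> twf n t \<and> twf n u"
| "twf n (TTwist j k) \<longleftrightarrow> True"
| "twf n (TTwistInv j k) \<longleftrightarrow> True"
| "twf n TEta \<longleftrightarrow> True"
| "twf n TEps \<longleftrightarrow> True"
| "twf n TR \<longleftrightarrow> True"
| "twf n TS \<longleftrightarrow> True"

inductive tangle_eq :: "nat \<Rightarrow> tangle_term \<Rightarrow> tangle_term \<Rightarrow> bool" for n :: nat where
  refl: "twf n t \<Longrightarrow> tangle_eq n t t"
| sym: "tangle_eq n t u \<Longrightarrow> tangle_eq n u t"
| trans: "tangle_eq n t u \<Longrightarrow> tangle_eq n u v \<Longrightarrow> tangle_eq n t v"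
| cong_Cmp: "tangle_eq n t t' \<Longrightarrow> tangle_eq n u u' \<Longrightarrow> tdom n t = tcod n u
    \<Longrightarrow> tangle_eq n (TCmp t u) (TCmp t' u')"
| cong_Ten: "tangle_eq n t t' \<Longrightarrow> tangle_eq n u u' \<Longrightarrow> tangle_eq n (TTen t u) (TTen t' u')"
| Idn_left: "twf n t \<Longrightarrow> tangle_eq n (TCmp (TIdn (tcod n t)) t) t"
| Idn_right: "twf n t \<Longrightarrow> tangle_eq n (TCmp t (TIdn (tdom n t))) t"
| Cmp_assoc: "twf n t \<Longrightarrow> twf n u \<Longrightarrow> twf n v \<Longrightarrow> tdom n t = tcod n u \<Longrightarrow> tdom n u = tcod n v
    \<Longrightarrow> tangle_eq n (TCmp (TCmp t u) v) (TCmp t (TCmp u v))"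
| Ten_Idn: "tangle_eq n (TTen (TIdn j) (TIdn k)) (TIdn (j + k))"
| Ten_Cmp: "twf n t \<Longrightarrow> twf n u \<Longrightarrow> twf n t' \<Longrightarrow> twf n u' \<Longrightarrow> tdom n t = tcod n u
    \<Longrightarrow> tdom n t' = tcod n u'
    \<Longrightarrow> tangle_eq n (TTen (TCmp t u) (TCmp t' u')) (TCmp (TTen t t') (TTen u u'))"
| Ten_assoc: "twf n t \<Longrightarrow> twf n u \<Longrightarrow> twf n v
    \<Longrightarrow> tangle_eq n (TTen (TTen t u) v) (TTen t (TTen u v))"
| Ten_left: "twf n t \<Longrightarrow> tangle_eq n (TTen (TIdn 0) t) t"
| Ten_right: "twf n t \<Longrightarrow> tangle_eq n (TTen t (TIdn 0)) t"
| Twist_inv_left: "tangle_eq n (TCmp (TTwistInv j k) (TTwist j k)) (TIdn (j + k))"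
| Twist_inv_right: "tangle_eq n (TCmp (TTwist j k) (TTwistInv j k)) (TIdn (k + j))"
| Twist_natural: "twf n t \<Longrightarrow> twf n u
    \<Longrightarrow> tangle_eq n (TCmp (TTwist (tcod n t) (tcod n u)) (TTen t u))
                     (TCmp (TTen u t) (TTwist (tdom n t) (tdom n u)))"
| Twist_right: "tangle_eq n (TTwist i (j + k))
    (TCmp (TTen (TIdn j) (TTwist i k)) (TTen (TTwist i j) (TIdn k)))"
| Twist_left: "tangle_eq n (TTwist (i + j) k)
    (TCmp (TTen (TTwist i k) (TIdn j)) (TTen (TIdn i) (TTwist j k)))"
| snake_left: "tangle_eq n (TCmp (TTen TEps (TIdn 1)) (TTen (TIdn 1) TEta)) (TIdn 1)"
| snake_right: "tangle_eq n (TCmp (TTen (TIdn 1) TEps) (TTen TEta (TIdn 1))) (TIdn 1)"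
| eps_Twist: "tangle_eq n (TCmp TEps (TTwist 1 1)) TEps"
| Twist_eta: "tangle_eq n (TCmp (TTwist 1 1) TEta) TEta"

definition tclass :: "nat \<Rightarrow> tangle_term \<Rightarrow> tangle_term set" where
  "tclass n t = {u. tangle_eq n t u}"

definition trep :: "tangle_term set \<Rightarrow> tangle_term" where
  "trep x = (SOME t. t \<in> x)"

definition Tangle :: "nat \<Rightarrow> (nat, tangle_term set) tensor_category" where
  "Tangle n =
    \<lparr> Ob = UNIV,
      Arr = {tclass n t | t. twf n t},
      Dom = (\<lambda>x. tdom n (trep x)),
      Cod = (\<lambda>x. tcod n (trep x)),
      Idn = (\<lambda>k. tclass n (TIdn k)),
      Cmp = (\<lambda>x y. tclass n (TCmp (trep x) (trep y))),
      Ten_o = (+),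
      Ten_a = (\<lambda>x y. tclass n (TTen (trep x) (trep y))),
      Unit = 0,
      Twist = (\<lambda>j k. tclass n (TTwist j k)) \<rparr>"

definition Tangle_eta :: "nat \<Rightarrow> tangle_term set" where "Tangle_eta n = tclass n TEta"
definition Tangle_eps :: "nat \<Rightarrow> tangle_term set" where "Tangle_eps n = tclass n TEps"
definition Tangle_R :: "nat \<Rightarrow> tangle_term set" where "Tangle_R n = tclass n TR"
definition Tangle_S :: "nat \<Rightarrow> tangle_term set" where "Tangle_S n = tclass n TS"


lemma HomI: "f \<in> Arr C \<Longrightarrow> Dom C f = X \<Longrightarrow> Cod C f = Y \<Longrightarrow> f \<in> Hom C X Y"
  by (simp add: Hom_def)

lemma HomD: "f \<in> Hom C X Y \<Longrightarrow> f \<in> Arr C \<and> Dom C f = X \<and> Cod C f = Y"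
  by (simp add: Hom_def)

lemma tangle_eq_typing:
  "tangle_eq n t u \<Longrightarrow> twf n t \<and> twf n u \<and> tdom n t = tdom n u \<and> tcod n t = tcod n u"
  by (induction rule: tangle_eq.induct) auto

lemma trep_tclass: "twf n t \<Longrightarrow> tangle_eq n t (trep (tclass n t))"
  unfolding trep_def tclass_def using someI[of "\<lambda>u. tangle_eq n t u" t]
  by (simp add: tangle_eq.refl)

lemma tclass_eq: "tangle_eq n t u \<Longrightarrow> tclass n t = tclass n u"
  unfolding tclass_def by (auto intro: tangle_eq.sym tangle_eq.trans)

lemma tclass_eqD: "tclass n t = tclass n u \<Longrightarrow> twf n u \<Longrightarrow> tangle_eq n t u"
  unfolding tclass_def using tangle_eq.refl by blast

lemma tclass_eq_iff:
  "twf n t \<Longrightarrow> twf n u \<Longrightarrow> tclass n t = tclass n u \<longleftrightarrow> tangle_eq n t u"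
  using tclass_eq tclass_eqD by blast

lemma Tangle_Arr: "x \<in> Arr (Tangle n) \<longleftrightarrow> (\<exists>t. twf n t \<and> x = tclass n t)"
  by (auto simp: Tangle_def)

lemma Tangle_Dom: "twf n t \<Longrightarrow> Dom (Tangle n) (tclass n t) = tdom n t"
  using tangle_eq_typing[OF trep_tclass] by (simp add: Tangle_def)

lemma Tangle_Cod: "twf n t \<Longrightarrow> Cod (Tangle n) (tclass n t) = tcod n t"
  using tangle_eq_typing[OF trep_tclass] by (simp add: Tangle_def)

lemma Tangle_Ob: "X \<in> Ob (Tangle n)"
  by (simp add: Tangle_def)

lemma Tangle_Idn: "Idn (Tangle n) k = tclass n (TIdn k)"
  by (simp add: Tangle_def)

lemma Tangle_Cmp: "twf n t \<Longrightarrow> twf n u \<Longrightarrow> tdom n t = tcod n u \<Longrightarrow>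
    Cmp (Tangle n) (tclass n t) (tclass n u) = tclass n (TCmp t u)"
  by (simp add: Tangle_def)
    (intro tclass_eq tangle_eq.sym[OF tangle_eq.cong_Cmp] trep_tclass; assumption)

lemma Tangle_Ten_a: "twf n t \<Longrightarrow> twf n u \<Longrightarrow>
    Ten_a (Tangle n) (tclass n t) (tclass n u) = tclass n (TTen t u)"
  by (simp add: Tangle_def)
    (intro tclass_eq tangle_eq.sym[OF tangle_eq.cong_Ten] trep_tclass; assumption)

lemma Tangle_Ten_o: "Ten_o (Tangle n) j k = j + k"
  by (simp add: Tangle_def)

lemma Tangle_Unit: "Unit (Tangle n) = 0"
  by (simp add: Tangle_def)

lemma Tangle_Twist: "Twist (Tangle n) j k = tclass n (TTwist j k)"
  by (simp add: Tangle_def)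

lemmas Tangle_simps = Tangle_Dom Tangle_Cod Tangle_Ob Tangle_Idn Tangle_Cmp Tangle_Ten_a
  Tangle_Ten_o Tangle_Unit Tangle_Twist

lemma Tangle_tpow: "tpow (Tangle n) 1 k = k"
  by (induction k) (simp_all add: Tangle_Unit Tangle_Ten_o)

lemma Tangle_Hom:
  "x \<in> Hom (Tangle n) j k \<longleftrightarrow> (\<exists>t. twf n t \<and> tdom n t = j \<and> tcod n t = k \<and> x = tclass n t)"
  by (auto simp: Hom_def Tangle_Arr Tangle_Dom Tangle_Cod)

lemma Tangle_HomE:
  assumes "x \<in> Hom (Tangle n) j k"
  obtains t where "twf n t" "tdom n t = j" "tcod n t = k" "x = tclass n t"
  using assms by (auto simp: Tangle_Hom)

lemma Tangle_HomI: "twf n t \<Longrightarrow> tdom n t = j \<Longrightarrow> tcod n t = k \<Longrightarrow> tclass n t \<in> Hom (Tangle n) j k"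
  by (auto simp: Tangle_Hom)

lemma Tangle_Twist_inverse:
  "inverse_arrows (Tangle n) (Twist (Tangle n) j k) (tclass n (TTwistInv j k))"
proof -
  have "tclass n (TTwist j k) \<in> Arr (Tangle n)"
    by (auto simp: Tangle_Arr intro!: exI[of _ "TTwist j k"])
  moreover have "tclass n (TTwistInv j k) \<in> Hom (Tangle n) (k + j) (j + k)"
    by (rule Tangle_HomI) auto
  ultimately show ?thesis
    by (simp add: inverse_arrows_def Tangle_simps)
      (metis tclass_eq tangle_eq.Twist_inv_left tangle_eq.Twist_inv_right)
qed

lemma Tangle_braided: "braided_strict_monoidal_category (Tangle n)"
proof
  fix f g h X Y Z W X' Y' Z' f' g'
  show "f \<in> Arr (Tangle n) \<Longrightarrow> Dom (Tangle n) f \<in> Ob (Tangle n)" by (rule Tangle_Ob)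
  show "f \<in> Arr (Tangle n) \<Longrightarrow> Cod (Tangle n) f \<in> Ob (Tangle n)" by (rule Tangle_Ob)
  show "Idn (Tangle n) X \<in> Hom (Tangle n) X X"
    by (auto simp: Tangle_simps intro!: Tangle_HomI)
  show "f \<in> Hom (Tangle n) Y Z \<Longrightarrow> g \<in> Hom (Tangle n) X Y \<Longrightarrow>
      Cmp (Tangle n) f g \<in> Hom (Tangle n) X Z"
    by (elim Tangle_HomE) (auto simp: Tangle_simps intro!: Tangle_HomI)
  show "f \<in> Hom (Tangle n) X Y \<Longrightarrow> Cmp (Tangle n) (Idn (Tangle n) Y) f = f"
    by (elim Tangle_HomE)
      (auto simp: Tangle_simps intro!: tclass_eq[OF tangle_eq.Idn_left])
  show "f \<in> Hom (Tangle n) X Y \<Longrightarrow> Cmp (Tangle n) f (Idn (Tangle n) X) = f"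
    by (elim Tangle_HomE)
      (auto simp: Tangle_simps intro!: tclass_eq[OF tangle_eq.Idn_right])
  show "f \<in> Hom (Tangle n) Y Z \<Longrightarrow> g \<in> Hom (Tangle n) X Y \<Longrightarrow> h \<in> Hom (Tangle n) W X \<Longrightarrow>
      Cmp (Tangle n) (Cmp (Tangle n) f g) h = Cmp (Tangle n) f (Cmp (Tangle n) g h)"
    by (elim Tangle_HomE)
      (simp add: Tangle_simps tclass_eq[OF tangle_eq.Cmp_assoc])
  show "Unit (Tangle n) \<in> Ob (Tangle n)" by (rule Tangle_Ob)
  show "Ten_o (Tangle n) X Y \<in> Ob (Tangle n)" by (rule Tangle_Ob)
  show "Ten_o (Tangle n) (Ten_o (Tangle n) X Y) Z = Ten_o (Tangle n) X (Ten_o (Tangle n) Y Z)"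
    by (simp add: Tangle_simps)
  show "Ten_o (Tangle n) (Unit (Tangle n)) X = X" by (simp add: Tangle_simps)
  show "Ten_o (Tangle n) X (Unit (Tangle n)) = X" by (simp add: Tangle_simps)
  show "f \<in> Hom (Tangle n) X Y \<Longrightarrow> f' \<in> Hom (Tangle n) X' Y' \<Longrightarrow>
      Ten_a (Tangle n) f f' \<in> Hom (Tangle n) (Ten_o (Tangle n) X X') (Ten_o (Tangle n) Y Y')"
    by (elim Tangle_HomE) (auto simp: Tangle_simps intro!: Tangle_HomI)
  show "Ten_a (Tangle n) (Idn (Tangle n) X) (Idn (Tangle n) Y) =
      Idn (Tangle n) (Ten_o (Tangle n) X Y)"
    by (auto simp: Tangle_simps intro!: tclass_eq[OF tangle_eq.Ten_Idn])
  show "f \<in> Hom (Tangle n) Y Z \<Longrightarrow> g \<in> Hom (Tangle n) X Y \<Longrightarrow> f' \<in> Hom (Tangle n) Y' Z' \<Longrightarrow>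
      g' \<in> Hom (Tangle n) X' Y' \<Longrightarrow>
      Ten_a (Tangle n) (Cmp (Tangle n) f g) (Cmp (Tangle n) f' g') =
      Cmp (Tangle n) (Ten_a (Tangle n) f f') (Ten_a (Tangle n) g g')"
    by (elim Tangle_HomE)
      (simp add: Tangle_simps tclass_eq[OF tangle_eq.Ten_Cmp])
  show "f \<in> Arr (Tangle n) \<Longrightarrow> g \<in> Arr (Tangle n) \<Longrightarrow> h \<in> Arr (Tangle n) \<Longrightarrow>
      Ten_a (Tangle n) (Ten_a (Tangle n) f g) h = Ten_a (Tangle n) f (Ten_a (Tangle n) g h)"
    by (auto simp: Tangle_Arr Tangle_simps tclass_eq[OF tangle_eq.Ten_assoc])
  show "f \<in> Arr (Tangle n) \<Longrightarrow> Ten_a (Tangle n) (Idn (Tangle n) (Unit (Tangle n))) f = f"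
    by (auto simp: Tangle_Arr Tangle_simps tclass_eq[OF tangle_eq.Ten_left])
  show "f \<in> Arr (Tangle n) \<Longrightarrow> Ten_a (Tangle n) f (Idn (Tangle n) (Unit (Tangle n))) = f"
    by (auto simp: Tangle_Arr Tangle_simps tclass_eq[OF tangle_eq.Ten_right])
  show "Twist (Tangle n) X Y \<in>
      Hom (Tangle n) (Ten_o (Tangle n) X Y) (Ten_o (Tangle n) Y X)"
    by (auto simp: Tangle_simps intro!: Tangle_HomI)
  show "\<exists>g. inverse_arrows (Tangle n) (Twist (Tangle n) X Y) g"
    using Tangle_Twist_inverse by blast
  show "f \<in> Hom (Tangle n) X Y \<Longrightarrow> g \<in> Hom (Tangle n) X' Y' \<Longrightarrow>
      Cmp (Tangle n) (Twist (Tangle n) Y Y') (Ten_a (Tangle n) f g) =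
      Cmp (Tangle n) (Ten_a (Tangle n) g f) (Twist (Tangle n) X X')"
    by (elim Tangle_HomE)
      (simp add: Tangle_simps, metis tclass_eq[OF tangle_eq.Twist_natural])
  show "Twist (Tangle n) X (Ten_o (Tangle n) Y Z) =
      Cmp (Tangle n) (Ten_a (Tangle n) (Idn (Tangle n) Y) (Twist (Tangle n) X Z))
        (Ten_a (Tangle n) (Twist (Tangle n) X Y) (Idn (Tangle n) Z))"
    by (auto simp: Tangle_simps intro!: tclass_eq[OF tangle_eq.Twist_right])
  show "Twist (Tangle n) (Ten_o (Tangle n) X Y) Z =
      Cmp (Tangle n) (Ten_a (Tangle n) (Twist (Tangle n) X Z) (Idn (Tangle n) Y))
        (Ten_a (Tangle n) (Idn (Tangle n) X) (Twist (Tangle n) Y Z))"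
    by (auto simp: Tangle_simps intro!: tclass_eq[OF tangle_eq.Twist_left])
qed

theorem Tangle_blocked_tangle_algebra:
  "blocked_tangle_algebra (Tangle n) 1 (Tangle_eta n) (Tangle_eps n) n (Tangle_R n) (Tangle_S n)"
proof -
  interpret braided_strict_monoidal_category "Tangle n" by (rule Tangle_braided)
  note snakes = tangle_eq.snake_left tangle_eq.snake_right tangle_eq.eps_Twist tangle_eq.Twist_eta
  show ?thesis
    by unfold_locales
      (auto simp: Tangle_simps Tangle_tpow[simplified] Tangle_eta_def Tangle_eps_def
        Tangle_R_def Tangle_S_def intro!: Tangle_HomI tclass_eq snakes[simplified])
qed

lemma (in braided_strict_monoidal_category) inverse_arrows_unique:
  assumes "inverse_arrows C f g" "inverse_arrows C f h"
  shows "g = h"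
proof -
  have f: "f \<in> Hom C (Dom C f) (Cod C f)" and g: "g \<in> Hom C (Cod C f) (Dom C f)"
    and h: "h \<in> Hom C (Cod C f) (Dom C f)"
    using assms by (auto simp: inverse_arrows_def Hom_def)
  have "g = g \<cdot> (f \<cdot> h)" using assms Idn_right[OF g] by (simp add: inverse_arrows_def)
  also have "\<dots> = (g \<cdot> f) \<cdot> h" using Cmp_assoc[OF g f h] by simp
  also have "\<dots> = h" using assms Idn_left[OF h] by (simp add: inverse_arrows_def)
  finally show ?thesis .
qed

context blocked_tangle_algebra
begin

lemma tpow_Ob: "tpow C A k \<in> Ob C"
  by (induction k) (simp_all add: Unit_in_Ob Ten_o_in_Ob A_in_Ob)

lemma tpow_add: "tpow C A (j + k) = tpow C A j \<otimes>\<^sub>o tpow C A k"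
  by (induction k) (simp_all add: Ten_o_right Ten_o_assoc tpow_Ob A_in_Ob)

lemma tpow_1: "tpow C A (Suc 0) = A"
  by (simp add: Ten_o_left A_in_Ob)

lemma tpow_2: "tpow C A 2 = A \<otimes>\<^sub>o A"
  by (simp add: numeral_2_eq_2 Ten_o_left A_in_Ob)

primrec teval :: "tangle_term \<Rightarrow> 'a" where
  "teval (TIdn k) = \<iota> (tpow C A k)"
| "teval (TCmp t u) = teval t \<cdot> teval u"
| "teval (TTen t u) = teval t \<otimes>\<^sub>a teval u"
| "teval (TTwist j k) = \<tau> (tpow C A j) (tpow C A k)"
| "teval (TTwistInv j k) = (THE g. inverse_arrows C (\<tau> (tpow C A j) (tpow C A k)) g)"
| "teval TEta = \<eta>"
| "teval TEps = \<epsilon>"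
| "teval TR = R"
| "teval TS = S"

lemma teval_TwistInv: "inverse_arrows C (\<tau> (tpow C A j) (tpow C A k)) (teval (TTwistInv j k))"
proof -
  have "\<exists>!g. inverse_arrows C (\<tau> (tpow C A j) (tpow C A k)) g"
    using Twist_iso[OF tpow_Ob tpow_Ob] inverse_arrows_unique by blast
  from theI'[OF this] show ?thesis by simp
qed

lemma Twist_tpow_Hom: "\<tau> (tpow C A j) (tpow C A k) \<in> Hom C (tpow C A (j + k)) (tpow C A (k + j))"
  using Twist_Hom[OF tpow_Ob tpow_Ob] by (simp add: tpow_add)

lemma teval_Hom: "twf n t \<Longrightarrow> teval t \<in> Hom C (tpow C A (tdom n t)) (tpow C A (tcod n t))"
proof (induction t)
  case (TTwistInv j k)
  show ?case
    using teval_TwistInv[of j k] HomD[OF Twist_tpow_Hom[of j k]]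
    by (simp add: inverse_arrows_def)
next
  case TEta show ?case using eta_Hom by (simp add: tpow_2)
next
  case TEps show ?case using eps_Hom by (simp add: tpow_2)
qed (auto simp: Idn_Hom tpow_Ob Twist_Hom tpow_add R_Hom S_Hom
    intro: Cmp_Hom Ten_a_Hom simp del: tpow.simps(2))

lemma teval_Arr: "twf n t \<Longrightarrow> teval t \<in> Arr C"
  using HomD[OF teval_Hom] by simp

lemma teval_sound: "tangle_eq n t u \<Longrightarrow> teval t = teval u"
proof (induction rule: tangle_eq.induct)
  case (Cmp_assoc t u v)
  note H = Cmp_assoc(1-3)[THEN teval_Hom]
  show ?case
    using braided_strict_monoidal_category.Cmp_assoc[OF braided_strict_monoidal_category_axioms
        H(1) H(2)[folded Cmp_assoc(4)] H(3)[folded Cmp_assoc(5)]]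
    by simp
next
  case (Ten_Cmp t u t' u')
  note H = Ten_Cmp(1-4)[THEN teval_Hom]
  show ?case
    using Ten_a_Cmp[OF H(1) H(2)[folded Ten_Cmp(5)] H(3) H(4)[folded Ten_Cmp(6)]] by simp
next
  case (Twist_natural t u)
  show ?case
    using braided_strict_monoidal_category.Twist_natural[OF braided_strict_monoidal_category_axioms
        Twist_natural(1)[THEN teval_Hom] Twist_natural(2)[THEN teval_Hom]]
    by simp
next
  case (Twist_inv_left j k)
  show ?case
    using teval_TwistInv[of j k] HomD[OF Twist_tpow_Hom[of j k]] by (simp add: inverse_arrows_def)
next
  case (Twist_inv_right j k)
  show ?case
    using teval_TwistInv[of j k] HomD[OF Twist_tpow_Hom[of j k]] by (simp add: inverse_arrows_def)
next
  case (Idn_left t) then show ?case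
    using braided_strict_monoidal_category.Idn_left[OF braided_strict_monoidal_category_axioms teval_Hom]
    by simp
next
  case (Idn_right t) then show ?case
    using braided_strict_monoidal_category.Idn_right[OF braided_strict_monoidal_category_axioms teval_Hom]
    by simp
next
  case snake_left show ?case
    using tangle_algebra.snake_left[OF tangle_algebra_axioms] by (simp add: Ten_o_left A_in_Ob)
next
  case snake_right show ?case
    using tangle_algebra.snake_right[OF tangle_algebra_axioms] by (simp add: Ten_o_left A_in_Ob)
next
  case eps_Twist show ?case
    using tangle_algebra.eps_Twist[OF tangle_algebra_axioms] by (simp add: Ten_o_left A_in_Ob)
next
  case Twist_eta show ?case
    using tangle_algebra.Twist_eta[OF tangle_algebra_axioms] by (simp add: Ten_o_left A_in_Ob)
next
  case (Twist_right i j k)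
  show ?case
    using braided_strict_monoidal_category.Twist_right[OF braided_strict_monoidal_category_axioms
        tpow_Ob tpow_Ob tpow_Ob]
    by (simp add: tpow_add)
next
  case (Twist_left i j k)
  show ?case
    using braided_strict_monoidal_category.Twist_left[OF braided_strict_monoidal_category_axioms
        tpow_Ob tpow_Ob tpow_Ob]
    by (simp add: tpow_add)
next
  case (Ten_Idn j k) show ?case by (simp add: Ten_a_Idn tpow_Ob tpow_add)
next
  case (Ten_assoc t u v) then show ?case by (simp add: Ten_a_assoc teval_Arr)
next
  case (Ten_left t) then show ?case by (simp add: Ten_a_left teval_Arr)
next
  case (Ten_right t) then show ?case by (simp add: Ten_a_right teval_Arr)
qed simp_all

lemma teval_trep: "twf n t \<Longrightarrow> teval (trep (tclass n t)) = teval t"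
  using teval_sound[OF trep_tclass] by simp

theorem Tangle_free_existence:
  "\<exists>Fo Fa. strict_braided_functor (Tangle n) C Fo Fa \<and> Fo 1 = A \<and>
     Fa (Tangle_eta n) = \<eta> \<and> Fa (Tangle_eps n) = \<epsilon> \<and> Fa (Tangle_R n) = R \<and> Fa (Tangle_S n) = S"
proof (intro exI conjI)
  let ?Fa = "\<lambda>x. teval (trep x)"
  show "strict_braided_functor (Tangle n) C (tpow C A) ?Fa"
  proof
    fix f g X Y Z
    show "tpow C A X \<in> Ob C" by (rule tpow_Ob)
    show "f \<in> Hom (Tangle n) X Y \<Longrightarrow> ?Fa f \<in> Hom C (tpow C A X) (tpow C A Y)"
      by (elim Tangle_HomE) (use teval_Hom in \<open>auto simp: teval_trep\<close>)
    show "?Fa (Idn (Tangle n) X) = Idn C (tpow C A X)"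
      by (simp add: Tangle_Idn teval_trep)
    show "f \<in> Hom (Tangle n) Y Z \<Longrightarrow> g \<in> Hom (Tangle n) X Y \<Longrightarrow>
        ?Fa (Cmp (Tangle n) f g) = ?Fa f \<cdot> ?Fa g"
      by (elim Tangle_HomE) (simp add: Tangle_Cmp teval_trep)
    show "tpow C A (Unit (Tangle n)) = \<I>" by (simp add: Tangle_Unit)
    show "tpow C A (Ten_o (Tangle n) X Y) = tpow C A X \<otimes>\<^sub>o tpow C A Y"
      by (simp add: Tangle_Ten_o tpow_add)
    show "f \<in> Arr (Tangle n) \<Longrightarrow> g \<in> Arr (Tangle n) \<Longrightarrow>
        ?Fa (Ten_a (Tangle n) f g) = ?Fa f \<otimes>\<^sub>a ?Fa g"
      by (auto simp: Tangle_Arr Tangle_Ten_a teval_trep)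
    show "?Fa (Twist (Tangle n) X Y) = \<tau> (tpow C A X) (tpow C A Y)"
      by (simp add: Tangle_Twist teval_trep)
  qed
qed (simp_all add: Ten_o_left A_in_Ob Tangle_eta_def Tangle_eps_def Tangle_R_def Tangle_S_def teval_trep)

theorem Tangle_free_uniqueness:
  assumes F: "strict_braided_functor (Tangle n) C Fo Fa" and "Fo 1 = A"
    and "Fa (Tangle_eta n) = \<eta>" "Fa (Tangle_eps n) = \<epsilon>" "Fa (Tangle_R n) = R" "Fa (Tangle_S n) = S"
  shows "Fo k = tpow C A k" and "x \<in> Arr (Tangle n) \<Longrightarrow> Fa x = teval (trep x)"
proof -
  interpret F: strict_braided_functor "Tangle n" C Fo Fa by (rule F)
  show Fo: "Fo k = tpow C A k" for k
  proof (induction k)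
    case 0 show ?case using F.Fo_Unit by (simp add: Tangle_Unit)
  next
    case (Suc k) then show ?case
      using F.Fo_Ten[OF Tangle_Ob Tangle_Ob, of k 1] assms(2) by (simp add: Tangle_Ten_o)
  qed
  have "twf n t \<Longrightarrow> Fa (tclass n t) = teval t" for t
  proof (induction t)
    case (TIdn k) show ?case using F.Fa_Idn[OF Tangle_Ob, of k] by (simp add: Tangle_Idn Fo)
  next
    case (TCmp t u)
    have "tclass n t \<in> Hom (Tangle n) (tdom n t) (tcod n t)"
      "tclass n u \<in> Hom (Tangle n) (tdom n u) (tdom n t)"
      using TCmp.prems by (auto intro!: Tangle_HomI)
    from F.Fa_Cmp[OF this] show ?case
      using TCmp by (simp add: Tangle_Cmp)
  next
    case (TTen t u)
    have "tclass n t \<in> Arr (Tangle n)" "tclass n u \<in> Arr (Tangle n)"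
      using TTen.prems by (auto simp only: Tangle_Arr twf.simps)
    from F.Fa_Ten[OF this] show ?case
      using TTen by (simp add: Tangle_Ten_a)
  next
    case (TTwist j k)
    show ?case using F.Fa_Twist[OF Tangle_Ob Tangle_Ob, of j k] by (simp add: Tangle_Twist Fo)
  next
    case (TTwistInv j k)
    let ?t = "Twist (Tangle n) j k" and ?g = "tclass n (TTwistInv j k)"
    have t: "?t \<in> Hom (Tangle n) (j + k) (k + j)"
      by (auto simp: Tangle_Twist intro!: Tangle_HomI)
    have i: "inverse_arrows (Tangle n) ?t ?g" by (rule Tangle_Twist_inverse)
    then have g: "?g \<in> Hom (Tangle n) (k + j) (j + k)"
      using HomD[OF t] by (simp add: inverse_arrows_def)
    have "inverse_arrows C (Fa ?t) (Fa ?g)"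
      using i HomD[OF t] HomD[OF F.Fa_Hom[OF t]] F.Fa_Hom[OF g]
        F.Fa_Cmp[OF t g] F.Fa_Cmp[OF g t] F.Fa_Idn[OF Tangle_Ob]
      by (simp add: inverse_arrows_def)
    then show ?case
      using F.Fa_Twist[OF Tangle_Ob Tangle_Ob, of j k] Fo teval_TwistInv
        inverse_arrows_unique by metis
  qed (use assms in \<open>simp_all add: Tangle_eta_def Tangle_eps_def Tangle_R_def Tangle_S_def\<close>)
  then show "x \<in> Arr (Tangle n) \<Longrightarrow> Fa x = teval (trep x)"
    by (auto simp: Tangle_Arr teval_trep)
qed

end


section \<open>Blocked braids\<close>

text \<open>
  The generating object \<open>A\<close> of \<open>Tangle n\<close> is \<open>1\<close>, and \<open>A\<^sup>k\<close> is \<open>k\<close>. A tensor of identities and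
  (inverse) twists is an endomorphism, so in a composite \<open>A\<^sup>n \<rightarrow> A\<^sup>n\<close> every factor is one of \<open>A\<^sup>n\<close>.
\<close>

inductive_set braid_layers :: "nat \<Rightarrow> tangle_term set set" for n :: nat where
  Idn: "Idn (Tangle n) k \<in> braid_layers n"
| Twist: "Twist (Tangle n) 1 1 \<in> braid_layers n"
| Twist_inverse: "inverse_arrows (Tangle n) (Twist (Tangle n) 1 1) g \<Longrightarrow> g \<in> braid_layers n"
| Ten: "f \<in> braid_layers n \<Longrightarrow> g \<in> braid_layers n \<Longrightarrow> Ten_a (Tangle n) f g \<in> braid_layers n"

inductive_set braids :: "nat \<Rightarrow> tangle_term set set" for n :: nat where
  layer: "f \<in> braid_layers n \<Longrightarrow> f \<in> Hom (Tangle n) n n \<Longrightarrow> f \<in> braids n"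
| Cmp: "f \<in> braids n \<Longrightarrow> g \<in> braids n \<Longrightarrow> Cmp (Tangle n) f g \<in> braids n"

definition blocked_braid :: "nat \<Rightarrow> tangle_term set \<Rightarrow> tangle_term set" where
  "blocked_braid n B = Cmp (Tangle n) (Tangle_S n) (Cmp (Tangle n) B (Tangle_R n))"

text \<open>
  The product is given by the formula on representatives; \<open>BB_mult\<close> below shows that it does not
  depend on them.
\<close>

definition BB :: "nat \<Rightarrow> tangle_term set monoid" where
  "BB n =
    \<lparr> carrier = blocked_braid n ` braids n,
      monoid.mult = (\<lambda>x y. THE z. \<exists>B \<in> braids n. \<exists>B' \<in> braids n.
        x = blocked_braid n B \<and> y = blocked_braid n B' \<and>
        z = blocked_braid n (Cmp (Tangle n) B B')),
      one = blocked_braid n (Idn (Tangle n) n) \<rparr>"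

lemma Tangle_Hom_Idn: "Idn (Tangle n) k \<in> Hom (Tangle n) k k"
  by (auto simp: Tangle_Idn intro!: Tangle_HomI)

lemma Tangle_Hom_R: "Tangle_R n \<in> Hom (Tangle n) 0 n"
  by (auto simp: Tangle_R_def intro!: Tangle_HomI)

lemma Tangle_Hom_S: "Tangle_S n \<in> Hom (Tangle n) n 0"
  by (auto simp: Tangle_S_def intro!: Tangle_HomI)

lemmas Tangle_Hom_Cmp =
  braided_strict_monoidal_category.Cmp_Hom[OF Tangle_braided]
lemmas Tangle_assoc =
  braided_strict_monoidal_category.Cmp_assoc[OF Tangle_braided]

lemma braids_Hom: "B \<in> braids n \<Longrightarrow> B \<in> Hom (Tangle n) n n"
  by (induction rule: braids.induct) (auto intro: Tangle_Hom_Cmp)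

lemma braids_Idn: "Idn (Tangle n) n \<in> braids n"
  by (intro braids.layer braid_layers.Idn Tangle_Hom_Idn)

lemma Tangle_Hom_Ten:
  "f \<in> Hom (Tangle n) a b \<Longrightarrow> g \<in> Hom (Tangle n) c d \<Longrightarrow>
    Ten_a (Tangle n) f g \<in> Hom (Tangle n) (a + c) (b + d)"
  using braided_strict_monoidal_category.Ten_a_Hom[OF Tangle_braided, of f n a b g c d]
  by (simp add: Tangle_Ten_o)

lemma braid_layers_inverse:
  "f \<in> braid_layers n \<Longrightarrow>
    \<exists>k. \<exists>g\<in>braid_layers n. f \<in> Hom (Tangle n) k k \<and> g \<in> Hom (Tangle n) k k \<and>
      Cmp (Tangle n) g f = Idn (Tangle n) k \<and> Cmp (Tangle n) f g = Idn (Tangle n) k"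
proof (induction rule: braid_layers.induct)
  case (Idn k)
  show ?case
    using braid_layers.Idn Tangle_Hom_Idn
      braided_strict_monoidal_category.Idn_left[OF Tangle_braided Tangle_Hom_Idn] by blast
next
  case Twist
  have t: "Twist (Tangle n) 1 1 \<in> Hom (Tangle n) 2 2"
    by (auto simp: Tangle_Twist intro!: Tangle_HomI)
  show ?case
    using Tangle_Twist_inverse[of n 1 1] braid_layers.Twist_inverse HomD[OF t] t
    unfolding inverse_arrows_def by metis
next
  case (Twist_inverse g)
  have t: "Twist (Tangle n) 1 1 \<in> Hom (Tangle n) 2 2"
    by (auto simp: Tangle_Twist intro!: Tangle_HomI)
  show ?case
    using Twist_inverse braid_layers.Twist HomD[OF t] t
    unfolding inverse_arrows_def by metis
next
  case (Ten f g)
  then obtain k f' l g' where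
    f: "f \<in> Hom (Tangle n) k k" "f' \<in> Hom (Tangle n) k k" "f' \<in> braid_layers n"
      "Cmp (Tangle n) f' f = Idn (Tangle n) k" "Cmp (Tangle n) f f' = Idn (Tangle n) k" and
    g: "g \<in> Hom (Tangle n) l l" "g' \<in> Hom (Tangle n) l l" "g' \<in> braid_layers n"
      "Cmp (Tangle n) g' g = Idn (Tangle n) l" "Cmp (Tangle n) g g' = Idn (Tangle n) l"
    by blast
  note ten = braided_strict_monoidal_category.Ten_a_Cmp[OF Tangle_braided, symmetric]
    and idn = braided_strict_monoidal_category.Ten_a_Idn[OF Tangle_braided Tangle_Ob Tangle_Ob]
  have "Cmp (Tangle n) (Ten_a (Tangle n) f' g') (Ten_a (Tangle n) f g) = Idn (Tangle n) (k + l)"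
    using ten[OF f(2,1) g(2,1)] f(4) g(4) idn by (simp add: Tangle_Ten_o)
  moreover have "Cmp (Tangle n) (Ten_a (Tangle n) f g) (Ten_a (Tangle n) f' g') = Idn (Tangle n) (k + l)"
    using ten[OF f(1,2) g(1,2)] f(5) g(5) idn by (simp add: Tangle_Ten_o)
  ultimately show ?case
    using braid_layers.Ten[OF f(3) g(3)] Tangle_Hom_Ten[OF f(1) g(1)] Tangle_Hom_Ten[OF f(2) g(2)]
    by blast
qed

lemma braids_inverse:
  "B \<in> braids n \<Longrightarrow> \<exists>B'\<in>braids n. Cmp (Tangle n) B' B = Idn (Tangle n) n \<and>
     Cmp (Tangle n) B B' = Idn (Tangle n) n"
proof (induction rule: braids.induct)
  case (layer f)
  then obtain k g where "g \<in> braid_layers n" "f \<in> Hom (Tangle n) k k" "g \<in> Hom (Tangle n) k k"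
      "Cmp (Tangle n) g f = Idn (Tangle n) k" "Cmp (Tangle n) f g = Idn (Tangle n) k"
    using braid_layers_inverse by blast
  moreover have "k = n" using HomD[OF calculation(2)] HomD[OF layer(2)] by simp
  ultimately show ?case using braids.layer by blast
next
  case (Cmp f g)
  then obtain f' g' where
    f': "f' \<in> braids n" "Cmp (Tangle n) f' f = Idn (Tangle n) n" "Cmp (Tangle n) f f' = Idn (Tangle n) n" and
    g': "g' \<in> braids n" "Cmp (Tangle n) g' g = Idn (Tangle n) n" "Cmp (Tangle n) g g' = Idn (Tangle n) n"
    by blast
  note idl = braided_strict_monoidal_category.Idn_left[OF Tangle_braided]
  note H = Cmp(1,2)[THEN braids_Hom] f'(1)[THEN braids_Hom] g'(1)[THEN braids_Hom]
  have *: "Cmp (Tangle n) (Cmp (Tangle n) a b) (Cmp (Tangle n) c d) = Idn (Tangle n) n"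
    if "a \<in> Hom (Tangle n) n n" "b \<in> Hom (Tangle n) n n" "c \<in> Hom (Tangle n) n n" "d \<in> Hom (Tangle n) n n"
      "Cmp (Tangle n) b c = Idn (Tangle n) n" "Cmp (Tangle n) a d = Idn (Tangle n) n" for a b c d
  proof -
    have "Cmp (Tangle n) (Cmp (Tangle n) a b) (Cmp (Tangle n) c d)
        = Cmp (Tangle n) a (Cmp (Tangle n) b (Cmp (Tangle n) c d))"
      using that Tangle_assoc Tangle_Hom_Cmp by blast
    also have "\<dots> = Cmp (Tangle n) a (Cmp (Tangle n) (Cmp (Tangle n) b c) d)"
      using that Tangle_assoc by metis
    finally show ?thesis using that idl by simp
  qed
  show ?case
    using *[of g' f' f g] *[of f g g' f'] H f' g' braids.Cmp by blast
qed

lemma functor_braid_layers: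
  assumes "strict_braided_functor (Tangle n) (Tangle n) Fo Fa" and Fo: "\<And>k. Fo k = k"
    and "f \<in> braid_layers n"
  shows "Fa f = f"
  using assms(3)
proof (induction rule: braid_layers.induct)
  interpret F: strict_braided_functor "Tangle n" "Tangle n" Fo Fa by (rule assms(1))
  { case (Idn k) show ?case using F.Fa_Idn[OF Tangle_Ob, of k] by (simp add: Fo) }
  { case Twist show ?case using F.Fa_Twist[OF Tangle_Ob Tangle_Ob, of 1 1] by (simp add: Fo) }
  { case (Twist_inverse g)
    let ?t = "Twist (Tangle n) 1 1"
    have t: "?t \<in> Hom (Tangle n) 2 2"
      by (auto simp: Tangle_Twist intro!: Tangle_HomI)
    have g: "g \<in> Hom (Tangle n) 2 2"
      using Twist_inverse HomD[OF t] by (simp add: inverse_arrows_def)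
    have "Fa ?t = ?t" using F.Fa_Twist[OF Tangle_Ob Tangle_Ob, of 1 1] by (simp add: Fo)
    then have "inverse_arrows (Tangle n) ?t (Fa g)"
      using Twist_inverse HomD[OF t] F.Fa_Hom[OF g] F.Fa_Cmp[OF t g] F.Fa_Cmp[OF g t]
        F.Fa_Idn[OF Tangle_Ob, of 2]
      by (simp add: inverse_arrows_def Fo)
    from braided_strict_monoidal_category.inverse_arrows_unique[OF Tangle_braided this Twist_inverse]
    show ?case . }
  { case (Ten f g)
    have "f \<in> Arr (Tangle n)" "g \<in> Arr (Tangle n)"
      using Ten(1,2)[THEN braid_layers_inverse] by (auto dest: HomD)
    then show ?case using Ten F.Fa_Ten by simp }
qed

lemma functor_braids:
  assumes "strict_braided_functor (Tangle n) (Tangle n) Fo Fa" and "\<And>k. Fo k = k"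
    and "B \<in> braids n"
  shows "Fa B = B"
  using assms(3)
proof (induction rule: braids.induct)
  case (layer f) then show ?case using functor_braid_layers[OF assms(1,2)] by blast
next
  case (Cmp f g)
  then show ?case
    using strict_braided_functor.Fa_Cmp[OF assms(1) braids_Hom braids_Hom] by simp
qed

text \<open>
  Substituting \<open>B' R\<close> for \<open>R\<close> and \<open>S D'\<close> for \<open>S\<close> extends to an endofunctor of \<open>Tangle n\<close>, which
  makes the product independent of representatives.
\<close>

lemma blocked_braid_substitution:
  assumes B: "B \<in> braids n" and D: "D \<in> braids n" and B': "B' \<in> braids n" and D': "D' \<in> braids n"
    and eq: "blocked_braid n B = blocked_braid n D"
  shows "blocked_braid n (Cmp (Tangle n) D' (Cmp (Tangle n) B B')) =
         blocked_braid n (Cmp (Tangle n) D' (Cmp (Tangle n) D B'))"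
proof -
  let ?c = "Cmp (Tangle n)"
  let ?R = "?c B' (Tangle_R n)" and ?S = "?c (Tangle_S n) D'"
  interpret T: blocked_tangle_algebra "Tangle n" 1 "Tangle_eta n" "Tangle_eps n" n
    "Tangle_R n" "Tangle_S n" by (rule Tangle_blocked_tangle_algebra)
  have R: "?R \<in> Hom (Tangle n) 0 n" and S: "?S \<in> Hom (Tangle n) n 0"
    using B' D' braids_Hom Tangle_Hom_Cmp Tangle_Hom_R Tangle_Hom_S by blast+
  interpret T': blocked_tangle_algebra "Tangle n" 1 "Tangle_eta n" "Tangle_eps n" n ?R ?S
    by unfold_locales (use R S Tangle_tpow Tangle_Unit in auto)
  obtain Fo Fa where F: "strict_braided_functor (Tangle n) (Tangle n) Fo Fa" "Fo 1 = 1"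
      "Fa (Tangle_eta n) = Tangle_eta n" "Fa (Tangle_eps n) = Tangle_eps n"
      "Fa (Tangle_R n) = ?R" "Fa (Tangle_S n) = ?S"
    using T'.Tangle_free_existence by blast
  have Fo: "Fo k = k" for k
    using T'.Tangle_free_uniqueness(1)[OF F] Tangle_tpow by simp
  have *: "Fa (blocked_braid n X) = blocked_braid n (?c D' (?c X B'))" if X: "X \<in> braids n" for X
  proof -
    note H = Tangle_Hom_R[of n] Tangle_Hom_S[of n] braids_Hom[OF X] braids_Hom[OF B'] braids_Hom[OF D']
    have XR: "?c X (Tangle_R n) \<in> Hom (Tangle n) 0 n" and XB: "?c X B' \<in> Hom (Tangle n) n n"
      using H Tangle_Hom_Cmp by blast+
    have "Fa (blocked_braid n X) = ?c ?S (?c X ?R)"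
      unfolding blocked_braid_def
      using strict_braided_functor.Fa_Cmp[OF F(1) H(2) XR]
        strict_braided_functor.Fa_Cmp[OF F(1) H(3) H(1)] F functor_braids[OF F(1) Fo X] by simp
    also have "\<dots> = ?c ?S (?c (?c X B') (Tangle_R n))"
      using Tangle_assoc[OF H(3) H(4) H(1)] by simp
    also have "\<dots> = ?c (Tangle_S n) (?c D' (?c (?c X B') (Tangle_R n)))"
      using Tangle_assoc[OF H(2) H(5)] Tangle_Hom_Cmp[OF XB H(1)] by blast
    also have "\<dots> = blocked_braid n (?c D' (?c X B'))"
      unfolding blocked_braid_def using Tangle_assoc[OF H(5) XB H(1)] by simp
    finally show ?thesis .
  qed
  show ?thesis using *[OF B] *[OF D] eq by simp
qed

lemma BB_mult:
  assumes B: "B \<in> braids n" and B': "B' \<in> braids n"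
  shows "blocked_braid n B \<otimes>\<^bsub>BB n\<^esub> blocked_braid n B' = blocked_braid n (Cmp (Tangle n) B B')"
proof -
  let ?c = "Cmp (Tangle n)"
  note idl = braided_strict_monoidal_category.Idn_left[OF Tangle_braided]
    and idr = braided_strict_monoidal_category.Idn_right[OF Tangle_braided]
  have "blocked_braid n (?c D D') = blocked_braid n (?c B B')"
    if D: "D \<in> braids n" and D': "D' \<in> braids n"
      and "blocked_braid n B = blocked_braid n D" "blocked_braid n B' = blocked_braid n D'" for D D'
  proof -
    have "blocked_braid n (?c B B') = blocked_braid n (?c D B')"
      using blocked_braid_substitution[OF B D B' braids_Idn that(3)]
        idl[OF Tangle_Hom_Cmp] braids_Hom B D B' by metis
    also have "\<dots> = blocked_braid n (?c D D')"
      using blocked_braid_substitution[OF B' D' braids_Idn D that(4)]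
        idr braids_Hom B' D' by metis
    finally show ?thesis by simp
  qed
  then have *: "z = blocked_braid n (?c B B')"
    if "\<exists>D \<in> braids n. \<exists>D' \<in> braids n. blocked_braid n B = blocked_braid n D \<and>
      blocked_braid n B' = blocked_braid n D' \<and> z = blocked_braid n (?c D D')" for z
    using that by blast
  show ?thesis
    unfolding BB_def monoid.simps
    by (rule the_equality) (use B B' in blast, rule *)
qed

lemma BB_one: "\<one>\<^bsub>BB n\<^esub> = blocked_braid n (Idn (Tangle n) n)"
  by (simp add: BB_def)

lemma BB_carrier: "carrier (BB n) = blocked_braid n ` braids n"
  by (simp add: BB_def)

theorem BB_group: "group (BB n)"
proof (rule groupI)
  fix x y z
  assume "x \<in> carrier (BB n)" "y \<in> carrier (BB n)" "z \<in> carrier (BB n)"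
  then obtain B D E where B: "B \<in> braids n" "x = blocked_braid n B"
    and D: "D \<in> braids n" "y = blocked_braid n D" and E: "E \<in> braids n" "z = blocked_braid n E"
    by (auto simp: BB_carrier)
  show "x \<otimes>\<^bsub>BB n\<^esub> y \<in> carrier (BB n)"
    using B D by (auto simp: BB_mult BB_carrier intro: braids.Cmp)
  show "x \<otimes>\<^bsub>BB n\<^esub> y \<otimes>\<^bsub>BB n\<^esub> z = x \<otimes>\<^bsub>BB n\<^esub> (y \<otimes>\<^bsub>BB n\<^esub> z)"
    using B D E Tangle_assoc[OF B(1)[THEN braids_Hom] D(1)[THEN braids_Hom] E(1)[THEN braids_Hom]]
    by (simp add: BB_mult braids.Cmp)
  show "\<one>\<^bsub>BB n\<^esub> \<otimes>\<^bsub>BB n\<^esub> x = x"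
    using B braided_strict_monoidal_category.Idn_left[OF Tangle_braided braids_Hom]
    by (simp add: BB_one BB_mult braids_Idn)
  show "\<exists>y\<in>carrier (BB n). y \<otimes>\<^bsub>BB n\<^esub> x = \<one>\<^bsub>BB n\<^esub>"
  proof -
    obtain B' where B': "B' \<in> braids n" "Cmp (Tangle n) B' B = Idn (Tangle n) n"
      using braids_inverse B(1) by blast
    then have "blocked_braid n B' \<otimes>\<^bsub>BB n\<^esub> x = \<one>\<^bsub>BB n\<^esub>"
      using B by (simp add: BB_one BB_mult)
    then show ?thesis using B' by (auto simp: BB_carrier)
  qed
qed (simp add: BB_one BB_carrier braids_Idn)

lemma BB_inverse:
  assumes "B \<in> braids n" and i: "inverse_arrows (Tangle n) B B'"
  shows "B' \<in> braids n" and "inv\<^bsub>BB n\<^esub> (blocked_braid n B) = blocked_braid n B'"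
proof -
  obtain D where D: "D \<in> braids n" "Cmp (Tangle n) D B = Idn (Tangle n) n"
      "Cmp (Tangle n) B D = Idn (Tangle n) n"
    using braids_inverse assms(1) by blast
  have "inverse_arrows (Tangle n) B D"
    using D braids_Hom[OF D(1)] HomD[OF braids_Hom[OF assms(1)]] by (simp add: inverse_arrows_def)
  from braided_strict_monoidal_category.inverse_arrows_unique[OF Tangle_braided this i]
  have "D = B'" .
  with D show "B' \<in> braids n" by simp
  interpret group "BB n" by (rule BB_group)
  show "inv\<^bsub>BB n\<^esub> (blocked_braid n B) = blocked_braid n B'"
    using D \<open>D = B'\<close> assms(1)
    by (intro inv_equality) (auto simp: BB_mult BB_one BB_carrier)
qed

end

theory Submission
  imports Defs "HOL-Algebra.Generated_Groups"
begin

text \<open>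
  Write \<open>\<sigma>\<^sub>1 = \<tau> \<otimes> 1\<close> and \<open>\<sigma>\<^sub>2 = 1 \<otimes> \<tau>\<close>. The group \<open>BB 3\<close> is a
  quotient of the braid group of the sphere on three strands, which has order \<open>12\<close>, and has the
  symmetric group on three letters as a quotient.

  For the upper bound, any arrow \<open>R : I \<rightarrow> A \<otimes> M\<close> is \<open>(1 \<otimes> g) \<eta>\<close> for some \<open>g : A \<rightarrow> M\<close>
  (\<open>bend_strand\<close>). Naturality then moves a double twist of \<open>A\<close> with \<open>M\<close> down to a double twist on
  \<open>\<eta>\<close>, which disappears because \<open>\<tau> \<eta> = \<eta>\<close>: a strand of the block that encircles all the others
  slips off over the block (\<open>encircling_strand_slips_off\<close>). For three strings this says
  \<open>\<sigma>\<^sub>1 \<sigma>\<^sub>2 \<sigma>\<^sub>2 \<sigma>\<^sub>1 R = R\<close>. Together with the braid relation it forces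
  \<open>z = \<sigma>\<^sub>1\<^sup>2 = \<sigma>\<^sub>2\<^sup>2\<close> to be central with \<open>z\<^sup>2 = 1\<close>, so that every element of the group is one of the
  six words \<open>1, \<sigma>\<^sub>1, \<sigma>\<^sub>2, \<sigma>\<^sub>1\<sigma>\<^sub>2, \<sigma>\<^sub>2\<sigma>\<^sub>1, \<sigma>\<^sub>1\<sigma>\<^sub>2\<sigma>\<^sub>1\<close> or \<open>z\<close> times such a word.

  For the lower bound, strings are interpreted as carriers of labels and tangles as relations between
  tuples of labels. If \<open>R\<close> emits \<open>[0, 1, 2]\<close> and \<open>S\<close> accepts only \<open>s\<close>, then \<open>S B R\<close> is the
  nonempty relation exactly when \<open>B\<close> permutes \<open>[0, 1, 2]\<close> into \<open>s\<close>. As \<open>s\<close> is arbitrary, the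
  blocked braid determines the permutation underlying \<open>B\<close>. The six words have distinct
  permutations, and multiplying by \<open>z\<close> does not change the permutation. Hence the order is \<open>6\<close> if
  \<open>z = 1\<close> and \<open>12\<close> otherwise (\<open>order_of_double_cover\<close>).
\<close>

section \<open>Twists in a tangle algebra\<close>

lemma (in braided_strict_monoidal_category) Ten_a_Cmp_left:
  assumes "f \<in> Hom C Y Z" "g \<in> Hom C X Y" "V \<in> Ob C"
  shows "(f \<cdot> g) \<otimes>\<^sub>a \<iota> V = (f \<otimes>\<^sub>a \<iota> V) \<cdot> (g \<otimes>\<^sub>a \<iota> V)"
  using Ten_a_Cmp[OF assms(1,2) Idn_Hom Idn_Hom] Idn_left[OF Idn_Hom] assms(3) by metis

lemma (in braided_strict_monoidal_category) Ten_a_Cmp_right: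
  assumes "f \<in> Hom C Y Z" "g \<in> Hom C X Y" "V \<in> Ob C"
  shows "\<iota> V \<otimes>\<^sub>a (f \<cdot> g) = (\<iota> V \<otimes>\<^sub>a f) \<cdot> (\<iota> V \<otimes>\<^sub>a g)"
  using Ten_a_Cmp[OF Idn_Hom Idn_Hom assms(1,2)] Idn_left[OF Idn_Hom] assms(3) by metis

lemma (in braided_strict_monoidal_category) inverse_arrows_Idn:
  assumes "X \<in> Ob C"
  shows "inverse_arrows C (\<iota> X) (\<iota> X)"
  using HomD[OF Idn_Hom[OF assms]] Idn_Hom[OF assms] Idn_left[OF Idn_Hom[OF assms]]
  by (simp add: inverse_arrows_def)

lemma (in braided_strict_monoidal_category) inverse_arrows_Ten:
  assumes f: "inverse_arrows C f f'" and g: "inverse_arrows C g g'"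
  shows "inverse_arrows C (f \<otimes>\<^sub>a g) (f' \<otimes>\<^sub>a g')"
proof -
  have homs: "f \<in> Hom C (Dom C f) (Cod C f)" "f' \<in> Hom C (Cod C f) (Dom C f)"
    "g \<in> Hom C (Dom C g) (Cod C g)" "g' \<in> Hom C (Cod C g) (Dom C g)"
    using f g by (auto simp: inverse_arrows_def Hom_def)
  have arrs: "f \<in> Arr C" "g \<in> Arr C"
    using f g by (simp_all add: inverse_arrows_def)
  note obs = Dom_in_Ob[OF arrs(1)] Cod_in_Ob[OF arrs(1)] Dom_in_Ob[OF arrs(2)] Cod_in_Ob[OF arrs(2)]
  note fg = Ten_a_Hom[OF homs(1,3)] and fg' = Ten_a_Hom[OF homs(2,4)]
  show ?thesis
    using HomD[OF fg] fg' Ten_a_Cmp[OF homs(1,2,3,4)] Ten_a_Cmp[OF homs(2,1,4,3)] f g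
      Ten_a_Idn[OF obs(1,3)] Ten_a_Idn[OF obs(2,4)]
    by (simp add: inverse_arrows_def)
qed

text \<open>
  The arrow \<open>g\<close> is obtained by pulling the \<open>A\<close>-leg of \<open>f\<close> down with \<open>\<epsilon>\<close>; pulling it up again with
  \<open>\<eta>\<close> is undone by one of the snake equations.
\<close>

lemma (in tangle_algebra) bend_strand:
  assumes M: "M \<in> Ob C" and f: "f \<in> Hom C \<I> (A \<otimes>\<^sub>o M)"
  obtains g where "g \<in> Hom C A M" "f = (\<iota> A \<otimes>\<^sub>a g) \<cdot> \<eta>"
proof
  let ?g = "(\<epsilon> \<otimes>\<^sub>a \<iota> M) \<cdot> (\<iota> A \<otimes>\<^sub>a f)"
  note obs = A_in_Ob M Unit_in_Ob Ten_o_in_Ob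
  have AA: "A \<otimes>\<^sub>o A \<in> Ob C" and AM: "A \<otimes>\<^sub>o M \<in> Ob C"
    using obs by blast+
  have e: "\<epsilon> \<otimes>\<^sub>a \<iota> M \<in> Hom C (A \<otimes>\<^sub>o A \<otimes>\<^sub>o M) M"
    using Ten_a_Hom[OF eps_Hom Idn_Hom[OF M]] obs by (simp add: Ten_o_left Ten_o_assoc)
  have h: "\<iota> A \<otimes>\<^sub>a f \<in> Hom C A (A \<otimes>\<^sub>o A \<otimes>\<^sub>o M)"
    using Ten_a_Hom[OF Idn_Hom[OF A_in_Ob] f] obs by (simp add: Ten_o_right)
  show "?g \<in> Hom C A M"
    using Cmp_Hom[OF e h] .
  have arr: "\<iota> A \<in> Arr C" "\<epsilon> \<in> Arr C" "\<iota> M \<in> Arr C" "f \<in> Arr C" "\<eta> \<in> Arr C"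
    using HomD[OF Idn_Hom[OF A_in_Ob]] HomD[OF Idn_Hom[OF M]] HomD[OF eps_Hom] HomD[OF f]
      HomD[OF eta_Hom] by auto
  have e': "(\<iota> A \<otimes>\<^sub>a \<epsilon>) \<otimes>\<^sub>a \<iota> M \<in> Hom C (A \<otimes>\<^sub>o A \<otimes>\<^sub>o A \<otimes>\<^sub>o M) (A \<otimes>\<^sub>o M)"
    using Ten_a_Hom[OF Idn_Hom[OF A_in_Ob] e] arr by (simp add: Ten_a_assoc)
  have h': "\<iota> (A \<otimes>\<^sub>o A) \<otimes>\<^sub>a f \<in> Hom C (A \<otimes>\<^sub>o A) (A \<otimes>\<^sub>o A \<otimes>\<^sub>o A \<otimes>\<^sub>o M)"
    using Ten_a_Hom[OF Idn_Hom[OF AA] f] obs by (simp add: Ten_o_right Ten_o_assoc)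
  have eta1: "\<eta> \<otimes>\<^sub>a \<iota> A \<in> Hom C A (A \<otimes>\<^sub>o A \<otimes>\<^sub>o A)"
    using Ten_a_Hom[OF eta_Hom Idn_Hom[OF A_in_Ob]] obs by (simp add: Ten_o_left Ten_o_assoc)
  have eps1: "\<iota> A \<otimes>\<^sub>a \<epsilon> \<in> Hom C (A \<otimes>\<^sub>o A \<otimes>\<^sub>o A) A"
    using Ten_a_Hom[OF Idn_Hom[OF A_in_Ob] eps_Hom] obs by (simp add: Ten_o_right)
  have eta2: "\<eta> \<otimes>\<^sub>a \<iota> (A \<otimes>\<^sub>o M) \<in> Hom C (A \<otimes>\<^sub>o M) (A \<otimes>\<^sub>o A \<otimes>\<^sub>o A \<otimes>\<^sub>o M)"
    using Ten_a_Hom[OF eta_Hom Idn_Hom[OF AM]] obs by (simp add: Ten_o_left Ten_o_assoc)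
  have "(\<iota> A \<otimes>\<^sub>a ?g) \<cdot> \<eta> = ((\<iota> A \<otimes>\<^sub>a \<epsilon> \<otimes>\<^sub>a \<iota> M) \<cdot> (\<iota> A \<otimes>\<^sub>a \<iota> A \<otimes>\<^sub>a f)) \<cdot> \<eta>"
    using Ten_a_Cmp_right[OF e h A_in_Ob] by simp
  also have "\<dots> = (((\<iota> A \<otimes>\<^sub>a \<epsilon>) \<otimes>\<^sub>a \<iota> M) \<cdot> (\<iota> (A \<otimes>\<^sub>o A) \<otimes>\<^sub>a f)) \<cdot> \<eta>"
    using arr A_in_Ob by (simp add: Ten_a_assoc Ten_a_Idn[symmetric])
  also have "\<dots> = ((\<iota> A \<otimes>\<^sub>a \<epsilon>) \<otimes>\<^sub>a \<iota> M) \<cdot> ((\<iota> (A \<otimes>\<^sub>o A) \<otimes>\<^sub>a f) \<cdot> \<eta>)"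
    by (rule Cmp_assoc[OF e' h' eta_Hom])
  \<comment> \<open>interchange: \<open>f\<close> and \<open>\<eta>\<close> both start at the unit object, so either may be applied first\<close>
  also have "(\<iota> (A \<otimes>\<^sub>o A) \<otimes>\<^sub>a f) \<cdot> \<eta> = (\<eta> \<otimes>\<^sub>a \<iota> (A \<otimes>\<^sub>o M)) \<cdot> f"
    using Ten_a_Cmp[OF Idn_Hom[OF AA] eta_Hom f Idn_Hom[OF Unit_in_Ob]]
      Ten_a_Cmp[OF eta_Hom Idn_Hom[OF Unit_in_Ob] Idn_Hom[OF AM] f]
      Idn_left[OF eta_Hom] Idn_right[OF eta_Hom] Idn_left[OF f] Idn_right[OF f] arr
    by (simp add: Ten_a_left Ten_a_right)
  also have "((\<iota> A \<otimes>\<^sub>a \<epsilon>) \<otimes>\<^sub>a \<iota> M) \<cdot> ((\<eta> \<otimes>\<^sub>a \<iota> (A \<otimes>\<^sub>o M)) \<cdot> f)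
      = (((\<iota> A \<otimes>\<^sub>a \<epsilon>) \<otimes>\<^sub>a \<iota> M) \<cdot> (\<eta> \<otimes>\<^sub>a \<iota> (A \<otimes>\<^sub>o M))) \<cdot> f"
    by (rule Cmp_assoc[OF e' eta2 f, symmetric])
  also have "((\<iota> A \<otimes>\<^sub>a \<epsilon>) \<otimes>\<^sub>a \<iota> M) \<cdot> (\<eta> \<otimes>\<^sub>a \<iota> (A \<otimes>\<^sub>o M)) = \<iota> (A \<otimes>\<^sub>o M)"
    using Ten_a_Cmp_left[OF eps1 eta1 M] snake_right arr obs
    by (simp add: Ten_a_Idn[symmetric] Ten_a_assoc)
  finally show "f = (\<iota> A \<otimes>\<^sub>a ?g) \<cdot> \<eta>"
    using Idn_left[OF f] by simp
qed

text \<open>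
  With \<open>f = (1 \<otimes> g) \<eta>\<close>, naturality carries \<open>g\<close> through both twists and leaves them acting on \<open>\<eta>\<close>,
  which absorbs them.
\<close>

lemma (in tangle_algebra) encircling_strand_slips_off:
  assumes M: "M \<in> Ob C" and f: "f \<in> Hom C \<I> (A \<otimes>\<^sub>o M)"
  shows "\<tau> M A \<cdot> (\<tau> A M \<cdot> f) = f"
proof -
  obtain g where g: "g \<in> Hom C A M" and fg: "f = (\<iota> A \<otimes>\<^sub>a g) \<cdot> \<eta>"
    using bend_strand[OF M f] .
  note idA = Idn_Hom[OF A_in_Ob]
  note t = Twist_Hom[OF A_in_Ob A_in_Ob]
  note ten = Ten_a_Hom[OF idA g] Ten_a_Hom[OF g idA]
  have "\<tau> A M \<cdot> f = (\<tau> A M \<cdot> (\<iota> A \<otimes>\<^sub>a g)) \<cdot> \<eta>"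
    unfolding fg by (rule Cmp_assoc[OF Twist_Hom[OF A_in_Ob M] ten(1) eta_Hom, symmetric])
  also have "\<dots> = (g \<otimes>\<^sub>a \<iota> A) \<cdot> (\<tau> A A \<cdot> \<eta>)"
    unfolding Twist_natural[OF idA g] by (rule Cmp_assoc[OF ten(2) t eta_Hom])
  finally have "\<tau> M A \<cdot> (\<tau> A M \<cdot> f) = \<tau> M A \<cdot> ((g \<otimes>\<^sub>a \<iota> A) \<cdot> \<eta>)"
    by (simp add: Twist_eta)
  also have "\<dots> = (\<tau> M A \<cdot> (g \<otimes>\<^sub>a \<iota> A)) \<cdot> \<eta>"
    by (rule Cmp_assoc[OF Twist_Hom[OF M A_in_Ob] ten(2) eta_Hom, symmetric])
  also have "\<dots> = (\<iota> A \<otimes>\<^sub>a g) \<cdot> (\<tau> A A \<cdot> \<eta>)"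
    unfolding Twist_natural[OF g idA] by (rule Cmp_assoc[OF ten(1) t eta_Hom])
  finally show ?thesis by (simp add: Twist_eta fg)
qed

text \<open>This is naturality of the twist of \<open>A\<close> with \<open>A \<otimes> A\<close>, applied to the arrow \<open>\<tau> A A\<close>.\<close>

lemma (in braided_strict_monoidal_category) braid_relation:
  assumes A: "A \<in> Ob C"
  shows "(\<tau> A A \<otimes>\<^sub>a \<iota> A) \<cdot> ((\<iota> A \<otimes>\<^sub>a \<tau> A A) \<cdot> (\<tau> A A \<otimes>\<^sub>a \<iota> A)) =
    (\<iota> A \<otimes>\<^sub>a \<tau> A A) \<cdot> ((\<tau> A A \<otimes>\<^sub>a \<iota> A) \<cdot> (\<iota> A \<otimes>\<^sub>a \<tau> A A))"
proof -
  note t = Twist_Hom[OF A A] and i = Idn_Hom[OF A]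
  have a: "\<tau> A A \<otimes>\<^sub>a \<iota> A \<in> Hom C (A \<otimes>\<^sub>o A \<otimes>\<^sub>o A) (A \<otimes>\<^sub>o A \<otimes>\<^sub>o A)"
    using Ten_a_Hom[OF t i] A by (simp add: Ten_o_assoc)
  show ?thesis
    using Twist_natural[OF i t] Cmp_assoc[OF Ten_a_Hom[OF i t] a Ten_a_Hom[OF i t]]
    by (simp add: Twist_right A)
qed

section \<open>Quotients of the sphere braid group on three strands\<close>

text \<open>
  Conjugating the relation \<open>x y y x = 1\<close> by \<open>x\<close> gives \<open>x\<^sup>2 y\<^sup>2 = 1\<close>. So \<open>x\<^sup>2\<close> is inverse to \<open>y\<^sup>2\<close> and
  therefore commutes with \<open>y\<close> as well as with \<open>x\<close>. The braid relation makes \<open>x\<close> and \<open>y\<close> conjugate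
  by \<open>x y\<close>, hence the central element \<open>x\<^sup>2\<close> equals \<open>y\<^sup>2\<close> and is its own inverse.
\<close>

lemma (in group) spherical_braid_relations:
  assumes x: "x \<in> carrier G" and y: "y \<in> carrier G"
    and braid: "x \<otimes> (y \<otimes> x) = y \<otimes> (x \<otimes> y)" and sphere: "x \<otimes> (y \<otimes> (y \<otimes> x)) = \<one>"
  shows "x \<otimes> x = y \<otimes> y" and "(x \<otimes> x) \<otimes> (x \<otimes> x) = \<one>"
proof -
  have "(x \<otimes> (y \<otimes> y)) \<otimes> x = \<one>"
    using x y sphere by (simp add: m_assoc)
  then have "x \<otimes> (x \<otimes> (y \<otimes> y)) = \<one>"
    using x y inv_comm by blast
  then have xy: "(x \<otimes> x) \<otimes> (y \<otimes> y) = \<one>"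
    using x y by (simp add: m_assoc)
  then have yx: "(y \<otimes> y) \<otimes> (x \<otimes> x) = \<one>"
    using x y inv_comm by blast
  have inv: "y \<otimes> y = inv (x \<otimes> x)"
    using yx x y by (simp add: inv_equality)
  have "y \<otimes> (y \<otimes> y) = (y \<otimes> y) \<otimes> y"
    using y by (simp add: m_assoc)
  then have yc: "(x \<otimes> x) \<otimes> y = y \<otimes> (x \<otimes> x)"
    using x y inv xy yx
    by (metis (no_types, lifting) inv_closed inv_inv m_assoc m_closed r_one l_one)
  have "(x \<otimes> y) \<otimes> (x \<otimes> x) = (y \<otimes> y) \<otimes> (x \<otimes> y)"
  proof -
    have "(x \<otimes> y) \<otimes> (x \<otimes> x) = (x \<otimes> (y \<otimes> x)) \<otimes> x"
      using x y by (simp add: m_assoc)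
    also have "\<dots> = y \<otimes> (x \<otimes> (y \<otimes> x))"
      using x y braid by (simp add: m_assoc)
    also have "\<dots> = (y \<otimes> y) \<otimes> (x \<otimes> y)"
      using x y braid by (simp add: m_assoc)
    finally show ?thesis .
  qed
  moreover have "(x \<otimes> y) \<otimes> (x \<otimes> x) = (x \<otimes> x) \<otimes> (x \<otimes> y)"
    using x y yc by (simp add: m_assoc)
  ultimately show "x \<otimes> x = y \<otimes> y"
    using x y by simp
  with xy show "(x \<otimes> x) \<otimes> (x \<otimes> x) = \<one>" by simp
qed

text \<open>
  The reduced words of the symmetric group on three letters in its two adjacent transpositions.
\<close>

definition (in monoid) sym3_words :: "'a \<Rightarrow> 'a \<Rightarrow> 'a set" where
  "sym3_words x y = {\<one>, x, y, x \<otimes> y, y \<otimes> x, x \<otimes> (y \<otimes> x)}"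

text \<open>
  The right-hand side is stable under left multiplication by \<open>x\<close> and \<open>y\<close>: such a product either
  lengthens or rearranges a reduced word, or produces a square of a generator, which is central and
  can be pulled out. Since \<open>x\<^sup>-\<^sup>1 = x\<^sup>3\<close> and \<open>y\<^sup>-\<^sup>1 = y\<^sup>3\<close>, it is also stable under the inverses.
\<close>

lemma (in group) generate_spherical_braids:
  assumes x: "x \<in> carrier G" and y: "y \<in> carrier G"
    and braid: "x \<otimes> (y \<otimes> x) = y \<otimes> (x \<otimes> y)" and sphere: "x \<otimes> (y \<otimes> (y \<otimes> x)) = \<one>"
  shows "generate G {x, y} \<subseteq> sym3_words x y \<union> (\<lambda>w. (x \<otimes> x) \<otimes> w) ` sym3_words x y"
    (is "_ \<subseteq> ?W \<union> ?s ` ?W")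
proof
  define z where "z = x \<otimes> x"
  have z: "z \<in> carrier G" "z = x \<otimes> x" "z = y \<otimes> y" "z \<otimes> z = \<one>"
    unfolding z_def using spherical_braid_relations[OF assms] x m_closed by metis+
  have zx: "x \<otimes> z = z \<otimes> x" using x by (simp add: z(2) m_assoc)
  have zy: "y \<otimes> z = z \<otimes> y" using y by (simp add: z(3) m_assoc)
  have zz: "z \<otimes> (z \<otimes> g) = g" if "g \<in> carrier G" for g
    using z that by (simp add: m_assoc[symmetric])
  have xx: "x \<otimes> (x \<otimes> g) = z \<otimes> g" if "g \<in> carrier G" for g
    using x that by (simp add: z(2) m_assoc)
  have yy: "y \<otimes> (y \<otimes> g) = z \<otimes> g" if "g \<in> carrier G" for g
    using y that by (simp add: z(3) m_assoc)
  have sub: "?W \<subseteq> carrier G" using x y by (auto simp: sym3_words_def)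
  let ?U = "?W \<union> (\<lambda>w. z \<otimes> w) ` ?W"
  have zU: "z \<otimes> u \<in> ?U" if "u \<in> ?U" for u
    using that zz sub by auto
  have W: "x \<otimes> w \<in> ?U \<and> y \<otimes> w \<in> ?U" if "w \<in> ?W" for w
  proof -
    have "y \<otimes> (x \<otimes> (y \<otimes> x)) = z \<otimes> (x \<otimes> y)"
      using x y braid yy by simp
    moreover have "y \<otimes> (x \<otimes> y) = x \<otimes> (y \<otimes> x)" by (rule braid[symmetric])
    ultimately show ?thesis
      using that x y xx yy z(2,3) z(1) unfolding sym3_words_def
      by (auto simp: image_iff)
  qed
  have U: "v \<otimes> u \<in> ?U" if v: "v \<in> {x, y}" and "u \<in> ?U" for u v
  proof (cases "u \<in> ?W")
    case True then show ?thesis using W v by blast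
  next
    case False
    then obtain w where w: "w \<in> ?W" "u = z \<otimes> w" using \<open>u \<in> ?U\<close> by blast
    have "v \<otimes> u = z \<otimes> (v \<otimes> w)"
      using w sub v zx zy x y z(1) by (auto simp: m_assoc[symmetric])
    moreover have "v \<otimes> w \<in> ?U" using W[OF w(1)] v by blast
    ultimately show ?thesis using zU by metis
  qed
  have Uc: "?U \<subseteq> carrier G" using sub z(1) by auto
  have inv: "inv v = v \<otimes> z" if "v \<in> {x, y}" for v
  proof -
    have v: "v \<in> carrier G" "v \<otimes> z = z \<otimes> v" "v \<otimes> v = z"
      using that x y z(2) z(3) zx zy by auto
    then have "(v \<otimes> z) \<otimes> v = \<one>"
      using z(1,4) by (simp add: m_assoc)
    with v show ?thesis using z(1,4) by (intro inv_equality) auto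
  qed
  fix h assume "h \<in> generate G {x, y}"
  then have "h \<in> carrier G \<and> (\<forall>u\<in>?U. h \<otimes> u \<in> ?U)"
  proof (induction rule: generate.induct)
    case one then show ?case using Uc by auto
  next
    case (incl h) then show ?case using U x y by auto
  next
    case (inv h)
    have "inv h \<otimes> u = h \<otimes> (z \<otimes> u)" if "u \<in> ?U" for u
      using that inv x y z(1) Uc inv.hyps \<open>\<And>v. v \<in> {x, y} \<Longrightarrow> inv v = v \<otimes> z\<close>
      by (auto simp: m_assoc)
    then show ?case using U zU inv x y by auto
  next
    case (eng h1 h2)
    have "(h1 \<otimes> h2) \<otimes> u = h1 \<otimes> (h2 \<otimes> u)" if "u \<in> ?U" for u
      using that Uc eng by (intro m_assoc) auto
    then show ?case using eng by auto
  qed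
  moreover have "\<one> \<in> ?U" by (simp add: sym3_words_def)
  ultimately show "h \<in> ?W \<union> ?s ` ?W" using r_one z(2) by metis
qed

text \<open>
  If some \<open>z \<otimes> w\<close> lies in \<open>W\<close>, the invariant \<open>f\<close> identifies it with \<open>w\<close>, so \<open>z = \<one>\<close>. Otherwise the
  two translates of \<open>W\<close> are disjoint.
\<close>

lemma (in group) order_of_double_cover:
  assumes z: "z \<in> carrier G" and W: "W \<subseteq> carrier G" "finite W" and one: "\<one> \<in> W"
    and cover: "carrier G \<subseteq> W \<union> (\<lambda>w. z \<otimes> w) ` W"
    and inj: "inj_on f W" and f: "\<And>w. w \<in> W \<Longrightarrow> f (z \<otimes> w) = f w"
  shows "finite (carrier G) \<and> (order G = card W \<or> order G = 2 * card W)"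
proof -
  let ?V = "(\<lambda>w. z \<otimes> w) ` W"
  have eq: "carrier G = W \<union> ?V" using cover W z by auto
  have fin: "finite (carrier G)" unfolding eq using W by simp
  have "card (carrier G) = card W \<or> card (carrier G) = 2 * card W"
  proof (cases "z = \<one>")
    case True
    then have "?V = W" using W by force
    then show ?thesis using eq by simp
  next
    case False
    have "W \<inter> ?V = {}"
    proof (rule ccontr)
      assume "W \<inter> ?V \<noteq> {}"
      then obtain w where w: "w \<in> W" "z \<otimes> w \<in> W" by auto
      then have "z \<otimes> w = w" using f inj by (auto dest: inj_onD)
      then show False using w(1) W(1) z False by (simp add: subset_iff)
    qed
    moreover have "card ?V = card W"
      using z W by (intro card_image inj_onI) (auto simp: subset_iff)
    ultimately show ?thesis unfolding eq using W by (simp add: card_Un_disjoint)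
  qed
  with fin show ?thesis by (simp add: order_def)
qed

section \<open>Tangles as relations between tuples of labels\<close>

text \<open>
  This is evaluation in the category of relations between lists, with the symmetry as twist and the
  diagonal as \<open>\<eta>\<close> and \<open>\<epsilon>\<close>. The block \<open>R\<close> becomes the point \<open>r\<close> and \<open>S\<close> the test for \<open>s\<close>.
\<close>

primrec label_rel :: "'c list \<Rightarrow> 'c list \<Rightarrow> tangle_term \<Rightarrow> ('c list \<times> 'c list) set" where
  "label_rel r s (TIdn k) = {(x, x) | x. length x = k}"
| "label_rel r s (TCmp t u) = label_rel r s u O label_rel r s t"
| "label_rel r s (TTen t u) = {(x @ x', y @ y') | x y x' y'. (x, y) \<in> label_rel r s t \<and> (x', y') \<in> label_rel r s u}"
| "label_rel r s (TTwist j k) = {(x @ y, y @ x) | x y. length x = j \<and> length y = k}"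
| "label_rel r s (TTwistInv j k) = {(y @ x, x @ y) | x y. length x = j \<and> length y = k}"
| "label_rel r s TEta = {([], [c, c]) | c. True}"
| "label_rel r s TEps = {([c, c], []) | c. True}"
| "label_rel r s TR = {([], r)}"
| "label_rel r s TS = {(s, [])}"

lemma label_rel_length:
  assumes "length r = n" "length s = n"
  shows "twf n t \<Longrightarrow> (x, y) \<in> label_rel r s t \<Longrightarrow> length x = tdom n t \<and> length y = tcod n t"
proof (induction t arbitrary: x y)
  case (TCmp t u) then show ?case by fastforce
next
  case (TTen t u) then show ?case by fastforce
qed (use assms in auto)

lemma relation_eqI: "(\<And>x y. (x, y) \<in> P \<longleftrightarrow> (x, y) \<in> Q) \<Longrightarrow> P = Q"
  by auto

lemma length_eq_add_iff:
  "length l = j + k \<longleftrightarrow> (\<exists>x y. l = x @ y \<and> length x = j \<and> length y = k)"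
  by (metis append_take_drop_id length_append length_take min.absorb2 le_add1 add_left_cancel)

lemma label_rel_TTen_iff:
  assumes "length r = n" "length s = n" "twf n t"
  shows "(v, w) \<in> label_rel r s (TTen t u) \<longleftrightarrow>
    (take (tdom n t) v, take (tcod n t) w) \<in> label_rel r s t \<and>
    (drop (tdom n t) v, drop (tcod n t) w) \<in> label_rel r s u"
proof
  assume "(v, w) \<in> label_rel r s (TTen t u)"
  then obtain x y x' y' where "v = x @ x'" "w = y @ y'" "(x, y) \<in> label_rel r s t" "(x', y') \<in> label_rel r s u"
    by auto
  then show "(take (tdom n t) v, take (tcod n t) w) \<in> label_rel r s t \<and>
      (drop (tdom n t) v, drop (tcod n t) w) \<in> label_rel r s u"
    using label_rel_length[OF assms(1,2,3)] by force
next
  assume "(take (tdom n t) v, take (tcod n t) w) \<in> label_rel r s t \<and>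
      (drop (tdom n t) v, drop (tcod n t) w) \<in> label_rel r s u"
  then show "(v, w) \<in> label_rel r s (TTen t u)"
    by simp (metis append_take_drop_id)
qed

lemma label_rel_TTwist_1_1: "label_rel r s (TTwist 1 1) = {([c, d], [d, c]) | c d. True}"
  by (auto simp: length_Suc_conv) (metis append_Cons append_Nil)

text \<open>
  Lengths decide where a concatenated list is to be cut, which is what makes the interchange law and
  the naturality of the twist hold in this model.
\<close>

lemma label_rel_sound:
  assumes r: "length r = n" and s: "length s = n"
  shows "tangle_eq n t u \<Longrightarrow> label_rel r s t = label_rel r s u"
proof (induction rule: tangle_eq.induct)
  case (Idn_left t)
  then show ?case using label_rel_length[OF r s, of t] by auto
next
  case (Idn_right t)
  then show ?case using label_rel_length[OF r s, of t] by auto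
next
  case (Cmp_assoc t u v)
  then show ?case by auto
next
  case (Ten_Idn j k)
  show ?case by (auto simp: length_eq_add_iff)
next
  case (Ten_Cmp t u t' u')
  show ?case
  proof (rule relation_eqI)
    fix x z
    have "(x, z) \<in> label_rel r s (TCmp (TTen t t') (TTen u u'))"
      if "(x, z) \<in> label_rel r s (TTen (TCmp t u) (TCmp t' u'))"
      using that by auto blast
    moreover have "(x, z) \<in> label_rel r s (TTen (TCmp t u) (TCmp t' u'))"
      if xz: "(x, z) \<in> label_rel r s (TCmp (TTen t t') (TTen u u'))"
    proof -
      obtain y where "(x, y) \<in> label_rel r s (TTen u u')" "(y, z) \<in> label_rel r s (TTen t t')"
        using xz unfolding label_rel.simps(2) by blast
      moreover have "twf n (TCmp t u)" using Ten_Cmp by simp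
      ultimately show ?thesis
        using Ten_Cmp by (auto simp: label_rel_TTen_iff[OF r s] simp del: label_rel.simps(3))
    qed
    ultimately show "(x, z) \<in> label_rel r s (TTen (TCmp t u) (TCmp t' u')) \<longleftrightarrow>
        (x, z) \<in> label_rel r s (TCmp (TTen t t') (TTen u u'))" by blast
  qed
next
  case (Ten_assoc t u v)
  show ?case by (simp, safe) (metis append.assoc)+
next
  case (Twist_inv_left j k)
  show ?case by (auto simp: length_eq_add_iff relcomp_unfold) blast
next
  case (Twist_inv_right j k)
  show ?case by (auto simp: length_eq_add_iff relcomp_unfold) blast
next
  case (Twist_natural t u)
  note len = label_rel_length[OF r s]
  show ?case
  proof (rule relation_eqI, rule iffI)
    fix v w
    assume "(v, w) \<in> label_rel r s (TCmp (TTwist (tcod n t) (tcod n u)) (TTen t u))"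
    then obtain m where m: "(v, m) \<in> label_rel r s (TTen t u)"
        "(m, w) \<in> label_rel r s (TTwist (tcod n t) (tcod n u))"
      unfolding label_rel.simps(2) by blast
    obtain x x' y y' where "v = x @ x'" "m = y @ y'" "(x, y) \<in> label_rel r s t" "(x', y') \<in> label_rel r s u"
      using m(1) by auto
    moreover obtain p q where "m = p @ q" "w = q @ p" "length p = tcod n t"
      using m(2) by auto
    ultimately have "(v, x' @ x) \<in> label_rel r s (TTwist (tdom n t) (tdom n u))" "(x' @ x, w) \<in> label_rel r s (TTen u t)"
      using len[of t x y] len[of u x' y'] Twist_natural by auto
    then show "(v, w) \<in> label_rel r s (TCmp (TTen u t) (TTwist (tdom n t) (tdom n u)))"
      unfolding label_rel.simps(2) by (rule relcompI)
  next
    fix v w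
    assume "(v, w) \<in> label_rel r s (TCmp (TTen u t) (TTwist (tdom n t) (tdom n u)))"
    then obtain m where m: "(v, m) \<in> label_rel r s (TTwist (tdom n t) (tdom n u))"
        "(m, w) \<in> label_rel r s (TTen u t)"
      unfolding label_rel.simps(2) by blast
    obtain x x' y y' where "m = x' @ x" "w = y' @ y" "(x, y) \<in> label_rel r s t" "(x', y') \<in> label_rel r s u"
      using m(2) by auto
    moreover obtain p q where "v = p @ q" "m = q @ p" "length q = tdom n u"
      using m(1) by auto
    ultimately have "(v, y @ y') \<in> label_rel r s (TTen t u)" "(y @ y', w) \<in> label_rel r s (TTwist (tcod n t) (tcod n u))"
      using len[of t x y] len[of u x' y'] Twist_natural by auto
    then show "(v, w) \<in> label_rel r s (TCmp (TTwist (tcod n t) (tcod n u)) (TTen t u))"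
      unfolding label_rel.simps(2) by (rule relcompI)
  qed
next
  case (Twist_right i j k)
  have "label_rel r s (TTwist i (j + k)) =
      {(x @ y @ z, y @ z @ x) | x y z. length x = i \<and> length y = j \<and> length z = k}"
    by (simp add: length_eq_add_iff, safe) (metis append.assoc)+
  moreover have "label_rel r s (TTen (TTwist i j) (TIdn k)) =
      {(x @ y @ z, y @ x @ z) | x y z. length x = i \<and> length y = j \<and> length z = k}"
    by (simp, safe) (metis append.assoc)+
  moreover have "label_rel r s (TTen (TIdn j) (TTwist i k)) =
      {(y @ x @ z, y @ z @ x) | x y z. length x = i \<and> length y = j \<and> length z = k}"
    by (simp, safe) (metis append.assoc)+
  ultimately show ?case by (auto simp: relcomp_unfold) blast
next
  case (Twist_left i j k)
  have "label_rel r s (TTwist (i + j) k) =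
      {(x @ y @ z, z @ x @ y) | x y z. length x = i \<and> length y = j \<and> length z = k}"
    by (simp add: length_eq_add_iff, safe) (metis append.assoc)+
  moreover have "label_rel r s (TTen (TTwist i k) (TIdn j)) =
      {(x @ z @ y, z @ x @ y) | x y z. length x = i \<and> length y = j \<and> length z = k}"
    by (simp, safe) (metis append.assoc)+
  moreover have "label_rel r s (TTen (TIdn i) (TTwist j k)) =
      {(x @ y @ z, x @ z @ y) | x y z. length x = i \<and> length y = j \<and> length z = k}"
    by (simp, safe) (metis append.assoc)+
  ultimately show ?case by (auto simp: relcomp_unfold) blast
next
  case snake_left
  show ?case by (auto simp: length_Suc_conv relcomp_unfold) (metis append_Cons append_Nil)
next
  case snake_right
  show ?case by (auto simp: length_Suc_conv relcomp_unfold) (metis append_Cons append_Nil)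
next
  case eps_Twist
  show ?case unfolding label_rel.simps(2) label_rel_TTwist_1_1 by auto
next
  case Twist_eta
  show ?case unfolding label_rel.simps(2) label_rel_TTwist_1_1 by auto
qed auto

section \<open>Blocked braids on three strings\<close>

definition first_crossing :: tangle_term (\<open>\<sigma>\<^sub>1\<close>) where
  "\<sigma>\<^sub>1 = TTen (TTwist 1 1) (TIdn 1)"

definition second_crossing :: tangle_term (\<open>\<sigma>\<^sub>2\<close>) where
  "\<sigma>\<^sub>2 = TTen (TIdn 1) (TTwist 1 1)"

lemma crossing_typing [simp]:
  "twf n \<sigma>\<^sub>1" "tdom n \<sigma>\<^sub>1 = 3" "tcod n \<sigma>\<^sub>1 = 3" "twf n \<sigma>\<^sub>2" "tdom n \<sigma>\<^sub>2 = 3" "tcod n \<sigma>\<^sub>2 = 3"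
  by (simp_all add: first_crossing_def second_crossing_def)

lemma Tangle_crossings:
  "Ten_a (Tangle n) (Twist (Tangle n) 1 1) (Idn (Tangle n) 1) = tclass n \<sigma>\<^sub>1"
  "Ten_a (Tangle n) (Idn (Tangle n) 1) (Twist (Tangle n) 1 1) = tclass n \<sigma>\<^sub>2"
  by (simp_all add: first_crossing_def second_crossing_def Tangle_simps)

lemma label_rel_crossings:
  "([p, q, c], y) \<in> label_rel r s \<sigma>\<^sub>1 \<longleftrightarrow> y = [q, p, c]"
  "([p, q, c], y) \<in> label_rel r s \<sigma>\<^sub>2 \<longleftrightarrow> y = [p, c, q]"
proof -
  have TTenI: "(x @ x', y @ y') \<in> label_rel r s (TTen t u)"
    if "(x, y) \<in> label_rel r s t" "(x', y') \<in> label_rel r s u" for x y x' y' t u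
    using that by auto
  have twist: "([d, e], [e, d]) \<in> label_rel r s (TTwist 1 1)" for d e
    unfolding label_rel_TTwist_1_1 by blast
  have "([p, q, c], [q, p, c]) \<in> label_rel r s \<sigma>\<^sub>1" "([p, q, c], [p, c, q]) \<in> label_rel r s \<sigma>\<^sub>2"
    using TTenI[OF twist, of "[c]" "[c]" "TIdn 1"] TTenI[OF _ twist, of "[p]" "[p]" "TIdn 1"]
    by (simp_all add: first_crossing_def second_crossing_def)
  moreover have "([p, q, c], y) \<in> label_rel r s \<sigma>\<^sub>1 \<Longrightarrow> y = [q, p, c]"
    "([p, q, c], y) \<in> label_rel r s \<sigma>\<^sub>2 \<Longrightarrow> y = [p, c, q]"
    by (auto simp: first_crossing_def second_crossing_def length_Suc_conv Cons_eq_append_conv)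
  ultimately show "([p, q, c], y) \<in> label_rel r s \<sigma>\<^sub>1 \<longleftrightarrow> y = [q, p, c]"
    "([p, q, c], y) \<in> label_rel r s \<sigma>\<^sub>2 \<longleftrightarrow> y = [p, c, q]" by blast+
qed

text \<open>
  The test \<open>s\<close> of the model varies, so that a blocked braid, which is a single yes-no answer in each
  model, reveals the whole permutation of its strings.
\<close>

definition exit_labels :: "tangle_term set \<Rightarrow> nat list set" where
  "exit_labels x = {s. length s = 3 \<and> label_rel [0, 1, 2] s (trep x) \<noteq> {}}"

lemma exit_labels_blocked_braid:
  assumes "twf 3 t" "tdom 3 t = 3" "tcod 3 t = 3"
  shows "exit_labels (blocked_braid 3 (tclass 3 t)) =
    {s. length s = 3 \<and> ([0, 1, 2], s) \<in> label_rel [0, 1, 2] s t}"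
proof -
  let ?t = "TCmp TS (TCmp t TR)"
  have t: "twf 3 ?t" using assms by simp
  have "blocked_braid 3 (tclass 3 t) = tclass 3 ?t"
    using assms by (simp add: blocked_braid_def Tangle_S_def Tangle_R_def Tangle_Cmp)
  moreover have "label_rel [0, 1, 2 :: nat] s (trep (tclass 3 ?t)) = label_rel [0, 1, 2] s ?t"
    if "length s = 3" for s
    using label_rel_sound[OF _ that trep_tclass[OF t], of "[0, 1, 2]"] by simp
  ultimately show ?thesis
    by (auto simp: exit_labels_def relcomp_unfold)
qed

lemma crossings_braids: "tclass 3 \<sigma>\<^sub>1 \<in> braids 3" "tclass 3 \<sigma>\<^sub>2 \<in> braids 3"
proof -
  have "tclass 3 \<sigma>\<^sub>1 \<in> braid_layers 3" "tclass 3 \<sigma>\<^sub>2 \<in> braid_layers 3"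
    using braid_layers.Ten[OF braid_layers.Twist braid_layers.Idn[of 3 1]]
      braid_layers.Ten[OF braid_layers.Idn[of 3 1] braid_layers.Twist]
    by (simp_all only: Tangle_crossings)
  then show "tclass 3 \<sigma>\<^sub>1 \<in> braids 3" "tclass 3 \<sigma>\<^sub>2 \<in> braids 3"
    by (auto intro!: braids.layer Tangle_HomI)
qed

lemma tclass_TCmp_braids:
  assumes "tclass 3 t \<in> braids 3" "tclass 3 u \<in> braids 3" "twf 3 t" "twf 3 u"
  shows "tclass 3 (TCmp t u) \<in> braids 3"
    and "blocked_braid 3 (tclass 3 t) \<otimes>\<^bsub>BB 3\<^esub> blocked_braid 3 (tclass 3 u) =
      blocked_braid 3 (tclass 3 (TCmp t u))"
proof -
  have "tdom 3 t = 3" "tcod 3 u = 3"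
    using HomD[OF braids_Hom[OF assms(1)]] HomD[OF braids_Hom[OF assms(2)]] assms(3,4)
    by (simp_all add: Tangle_Dom Tangle_Cod)
  then have "Cmp (Tangle 3) (tclass 3 t) (tclass 3 u) = tclass 3 (TCmp t u)"
    using assms by (simp add: Tangle_Cmp)
  then show "tclass 3 (TCmp t u) \<in> braids 3"
    "blocked_braid 3 (tclass 3 t) \<otimes>\<^bsub>BB 3\<^esub> blocked_braid 3 (tclass 3 u) =
      blocked_braid 3 (tclass 3 (TCmp t u))"
    using BB_mult[OF assms(1,2)] braids.Cmp[OF assms(1,2)] by simp_all
qed

lemma blocked_braid_relation:
  "blocked_braid 3 (tclass 3 (TCmp \<sigma>\<^sub>1 (TCmp \<sigma>\<^sub>2 \<sigma>\<^sub>1))) =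
   blocked_braid 3 (tclass 3 (TCmp \<sigma>\<^sub>2 (TCmp \<sigma>\<^sub>1 \<sigma>\<^sub>2)))"
  using braided_strict_monoidal_category.braid_relation[OF Tangle_braided Tangle_Ob, of 3 1]
  by (simp add: Tangle_crossings[unfolded One_nat_def] Tangle_Cmp)

text \<open>
  The word is \<open>\<tau>\<^bsub>A\<^sup>2,A\<^esub> \<tau>\<^bsub>A,A\<^sup>2\<^esub>\<close>, the loop of the first string around the other two, which slips
  off over the block.
\<close>

lemma blocked_sphere_relation:
  "blocked_braid 3 (tclass 3 (TCmp \<sigma>\<^sub>1 (TCmp \<sigma>\<^sub>2 (TCmp \<sigma>\<^sub>2 \<sigma>\<^sub>1)))) = blocked_braid 3 (Idn (Tangle 3) 3)"
proof -
  let ?C = "Tangle 3"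
  interpret blocked_tangle_algebra ?C 1 "Tangle_eta 3" "Tangle_eps 3" 3 "Tangle_R 3" "Tangle_S 3"
    by (rule Tangle_blocked_tangle_algebra)
  have 12: "Twist ?C 1 2 = tclass 3 (TCmp \<sigma>\<^sub>2 \<sigma>\<^sub>1)"
    using Twist_right[OF Tangle_Ob Tangle_Ob Tangle_Ob, of 1 1 1]
    by (simp add: Tangle_crossings[unfolded One_nat_def] Tangle_Ten_o Tangle_Cmp numeral_2_eq_2)
  have 21: "Twist ?C 2 1 = tclass 3 (TCmp \<sigma>\<^sub>1 \<sigma>\<^sub>2)"
    using Twist_left[OF Tangle_Ob Tangle_Ob Tangle_Ob, of 1 1 1]
    by (simp add: Tangle_crossings[unfolded One_nat_def] Tangle_Ten_o Tangle_Cmp numeral_2_eq_2)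
  have R: "Tangle_R 3 \<in> Hom ?C (Unit ?C) (Ten_o ?C 1 2)"
    using Tangle_Hom_R[of 3] by (simp add: Tangle_simps numeral_3_eq_3)
  have slip: "Cmp ?C (Twist ?C 2 1) (Cmp ?C (Twist ?C 1 2) (Tangle_R 3)) = Tangle_R 3"
    by (rule encircling_strand_slips_off[OF Tangle_Ob R])
  have "tangle_eq 3 (TCmp (TCmp \<sigma>\<^sub>1 \<sigma>\<^sub>2) (TCmp \<sigma>\<^sub>2 \<sigma>\<^sub>1)) (TCmp \<sigma>\<^sub>1 (TCmp \<sigma>\<^sub>2 (TCmp \<sigma>\<^sub>2 \<sigma>\<^sub>1)))"
    by (rule tangle_eq.Cmp_assoc) auto
  then have "tclass 3 (TCmp \<sigma>\<^sub>1 (TCmp \<sigma>\<^sub>2 (TCmp \<sigma>\<^sub>2 \<sigma>\<^sub>1))) = Cmp ?C (Twist ?C 2 1) (Twist ?C 1 2)"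
    unfolding 12 21 by (simp add: Tangle_Cmp tclass_eq)
  moreover have "Twist ?C 2 1 \<in> Hom ?C 3 3" "Twist ?C 1 2 \<in> Hom ?C 3 3"
    by (auto simp: Tangle_Twist intro!: Tangle_HomI)
  ultimately have "Cmp ?C (tclass 3 (TCmp \<sigma>\<^sub>1 (TCmp \<sigma>\<^sub>2 (TCmp \<sigma>\<^sub>2 \<sigma>\<^sub>1)))) (Tangle_R 3) = Tangle_R 3"
    using Tangle_assoc[OF _ _ Tangle_Hom_R] slip by metis
  then show ?thesis
    using Idn_left[OF Tangle_Hom_R] by (simp add: blocked_braid_def)
qed

text \<open>
  Layers are closed under arbitrary tensors, so the ones on three strings are reached only through
  layers on fewer strings; the cases \<open>k = 0\<close>, \<open>k = 1\<close> and \<open>k = 2\<close> make the induction work.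
\<close>

lemma braid_layers_small:
  fixes n
  defines "I \<equiv> Idn (Tangle n) 1" and "T \<equiv> Twist (Tangle n) 1 1" and "T' \<equiv> tclass n (TTwistInv 1 1)"
    and "ten \<equiv> Ten_a (Tangle n)"
  assumes "f \<in> braid_layers n"
  shows "\<exists>k. f \<in> Hom (Tangle n) k k \<and>
    (k = 0 \<longrightarrow> f = Idn (Tangle n) 0) \<and>
    (k = 1 \<longrightarrow> f = I) \<and>
    (k = 2 \<longrightarrow> f \<in> {Idn (Tangle n) 2, T, T'}) \<and>
    (k = 3 \<longrightarrow> f \<in> {Idn (Tangle n) 3, ten T I, ten T' I, ten I T, ten I T'})"
    (is "\<exists>k. ?P f k")
  using \<open>f \<in> braid_layers n\<close>
proof (induction rule: braid_layers.induct)
  case (Idn k)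
  have "?P (Idn (Tangle n) k) k" using Tangle_Hom_Idn by (auto simp: I_def)
  then show ?case by blast
next
  case Twist
  have "?P T 2" by (auto simp: T_def Tangle_Twist intro!: Tangle_HomI)
  then show ?case unfolding T_def by (rule exI)
next
  case (Twist_inverse g)
  have "g = T'"
    using braided_strict_monoidal_category.inverse_arrows_unique[OF Tangle_braided Twist_inverse
        Tangle_Twist_inverse] by (simp add: T'_def)
  have "?P T' 2" by (auto simp: T'_def intro!: Tangle_HomI)
  then show ?case unfolding \<open>g = T'\<close> by (rule exI)
next
  case (Ten f g)
  obtain k where f: "?P f k" using Ten.IH(1) by (rule exE)
  obtain l where g: "?P g l" using Ten.IH(2) by (rule exE)
  interpret braided_strict_monoidal_category "Tangle n" by (rule Tangle_braided)
  have hom: "ten f g \<in> Hom (Tangle n) (k + l) (k + l)"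
    unfolding ten_def using f g by (intro Tangle_Hom_Ten) (elim conjunct1)+
  have idn: "ten (Idn (Tangle n) i) (Idn (Tangle n) j) = Idn (Tangle n) (i + j)" for i j
    using Ten_a_Idn[OF Tangle_Ob Tangle_Ob] by (simp add: ten_def Tangle_Ten_o)
  have unit: "ten (Idn (Tangle n) 0) g = g" "ten f (Idn (Tangle n) 0) = f"
    using Ten_a_left[of g] Ten_a_right[of f] HomD[OF conjunct1[OF f]] HomD[OF conjunct1[OF g]]
    by (simp_all add: ten_def Tangle_Unit)
  consider "k = 0" | "l = 0" | "k = 1" "l = 1" | "k = 1" "l = 2" | "k = 2" "l = 1" | "k + l > 3"
    by linarith
  then have "?P (ten f g) (k + l)"
  proof cases
    case 1
    then have "ten f g = g" "k + l = l" using f unit(1) by simp_all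
    then show ?thesis using g by metis
  next
    case 2
    then have "ten f g = f" "k + l = k" using g unit(2) by simp_all
    then show ?thesis using f by metis
  next
    case 3 then show ?thesis using f g hom idn[of 1 1] by (simp add: I_def del: One_nat_def)
  next
    case 4 then show ?thesis using f g hom idn[of 1 2] by (auto simp: I_def simp del: One_nat_def)
  next
    case 5 then show ?thesis using f g hom idn[of 2 1] by (auto simp: I_def simp del: One_nat_def)
  next
    case 6 then show ?thesis using hom by auto
  qed
  then show ?case unfolding ten_def by (rule exI)
qed

lemma blocked_braids_generated:
  assumes "B \<in> braids 3"
  shows "blocked_braid 3 B \<in> generate (BB 3)
    {blocked_braid 3 (tclass 3 \<sigma>\<^sub>1), blocked_braid 3 (tclass 3 \<sigma>\<^sub>2)}" (is "_ \<in> ?H")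
  using assms
proof (induction rule: braids.induct)
  case (layer f)
  let ?C = "Tangle 3"
  interpret braided_strict_monoidal_category ?C by (rule Tangle_braided)
  let ?T' = "tclass 3 (TTwistInv 1 1)"
  have i1: "inverse_arrows ?C (tclass 3 \<sigma>\<^sub>1) (tclass 3 (TTen (TTwistInv 1 1) (TIdn 1)))"
    using inverse_arrows_Ten[OF Tangle_Twist_inverse inverse_arrows_Idn[OF Tangle_Ob], of 1 1 1]
    by (simp add: Tangle_simps first_crossing_def)
  have i2: "inverse_arrows ?C (tclass 3 \<sigma>\<^sub>2) (tclass 3 (TTen (TIdn 1) (TTwistInv 1 1)))"
    using inverse_arrows_Ten[OF inverse_arrows_Idn[OF Tangle_Ob] Tangle_Twist_inverse, of 1 1 1]
    by (simp add: Tangle_simps second_crossing_def)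
  have "f \<in> {Idn ?C 3, tclass 3 \<sigma>\<^sub>1, tclass 3 \<sigma>\<^sub>2, tclass 3 (TTen (TTwistInv 1 1) (TIdn 1)),
      tclass 3 (TTen (TIdn 1) (TTwistInv 1 1))}"
    using braid_layers_small[OF layer(1)] HomD[OF layer(2)]
    by (auto simp: Hom_def Tangle_simps first_crossing_def second_crossing_def)
  then show ?case
    using BB_inverse(2)[OF crossings_braids(1) i1] BB_inverse(2)[OF crossings_braids(2) i2]
      generate.one[of "BB 3"] BB_one[of 3]
    by (auto intro: generate.incl)
      (metis generate.inv insertI1 insertI2)+
next
  case (Cmp f g)
  then show ?case using BB_mult[OF Cmp(1,2)] generate.eng by metis
qed

theorem mainTheorem5:
  shows "finite (carrier (BB 3)) \<and> (order (BB 3) = 6 \<or> order (BB 3) = 12)"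
proof -
  interpret group "BB 3" by (rule BB_group)
  let ?b = "\<lambda>t. blocked_braid 3 (tclass 3 t)"
  let ?x = "?b \<sigma>\<^sub>1" and ?y = "?b \<sigma>\<^sub>2"
  let ?W = "sym3_words ?x ?y"
  have x: "?x \<in> carrier (BB 3)" and y: "?y \<in> carrier (BB 3)"
    using crossings_braids by (auto simp: BB_carrier)
  have one: "\<one>\<^bsub>BB 3\<^esub> = ?b (TIdn 3)" by (simp add: BB_one Tangle_Idn)
  note braids = crossings_braids tclass_TCmp_braids(1) braids_Idn[of 3, unfolded Tangle_Idn]
  note mult = tclass_TCmp_braids(2)
  have braid: "?x \<otimes>\<^bsub>BB 3\<^esub> (?y \<otimes>\<^bsub>BB 3\<^esub> ?x) = ?y \<otimes>\<^bsub>BB 3\<^esub> (?x \<otimes>\<^bsub>BB 3\<^esub> ?y)"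
    using blocked_braid_relation by (simp add: mult braids)
  have sphere: "?x \<otimes>\<^bsub>BB 3\<^esub> (?y \<otimes>\<^bsub>BB 3\<^esub> (?y \<otimes>\<^bsub>BB 3\<^esub> ?x)) = \<one>\<^bsub>BB 3\<^esub>"
    using blocked_sphere_relation by (simp add: mult braids BB_one)
  have cover: "carrier (BB 3) \<subseteq> ?W \<union> (\<lambda>w. (?x \<otimes>\<^bsub>BB 3\<^esub> ?x) \<otimes>\<^bsub>BB 3\<^esub> w) ` ?W"
    using generate_spherical_braids[OF x y braid sphere] blocked_braids_generated
    by (auto simp: BB_carrier)
  note observed = one mult braids exit_labels_blocked_braid label_rel_crossings relcomp_unfold
  have ob: "exit_labels \<one>\<^bsub>BB 3\<^esub> = {[0, 1, 2]}" "exit_labels ?x = {[1, 0, 2]}" "exit_labels ?y = {[0, 2, 1]}"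
    "exit_labels (?x \<otimes>\<^bsub>BB 3\<^esub> ?y) = {[2, 0, 1]}" "exit_labels (?y \<otimes>\<^bsub>BB 3\<^esub> ?x) = {[1, 2, 0]}"
    "exit_labels (?x \<otimes>\<^bsub>BB 3\<^esub> (?y \<otimes>\<^bsub>BB 3\<^esub> ?x)) = {[2, 1, 0]}"
    by (auto simp: observed)
  have ob': "exit_labels ((?x \<otimes>\<^bsub>BB 3\<^esub> ?x) \<otimes>\<^bsub>BB 3\<^esub> w) = exit_labels w" if "w \<in> ?W" for w
    using that unfolding sym3_words_def by (auto simp: observed)
  have inj: "inj_on exit_labels ?W"
    unfolding sym3_words_def by (auto simp: inj_on_def ob)
  have "exit_labels ` ?W = {{[0, 1, 2]}, {[1, 0, 2]}, {[0, 2, 1]}, {[2, 0, 1]}, {[1, 2, 0]}, {[2, 1, 0]}}"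
    unfolding sym3_words_def by (simp add: ob)
  then have "card ?W = 6"
    using card_image[OF inj] by simp
  moreover have "finite ?W" "?W \<subseteq> carrier (BB 3)" "\<one>\<^bsub>BB 3\<^esub> \<in> ?W"
    unfolding sym3_words_def using x y by auto
  ultimately show ?thesis
    using order_of_double_cover[OF m_closed[OF x x] _ _ _ cover inj] ob' by simp
qed

end
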